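(* For the $(1/2,1/2)$-deletion channel, $\mathrm{poly}(n)$ traces suffice to reconstruct $x\in\{0,1\}^n$ with high probability if every run of $0$s in $x$ has length $\tilde\Omega(r)$, where $r=1+|\{i\in[n-1]: x_i\neq x_{i+1}\}|$ is the number of runs in $x$.
   Context: The $(1/2,1/2)$-deletion channel takes $x\in\{0,1\}^n$ and deletes each coordinate independently with probability $1/2$, outputting the subsequence of surviving coordinates (deletion locations unknown); each output is a trace. A run is a maximal contiguous block of equal symbols. $\tilde\Omega(\cdot)$ hides polylogarithmic factors in $n$. "With high probability" means with probability at least $1-o(1)$ as $n\to\infty$. *)

theory Defs
  imports "HOL-Probability.Probability"
begin

text \<open>
  Binary strings are boolean lists, with \<open>True\<close> for the symbol 1 and \<open>False\<close> for the symbol 0.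
  Positions are numbered from 0.
\<close>

text \<open>
  \<open>K i\<close> is the event that coordinate \<open>i\<close> survives; the product distribution makes these
  independent, each of probability \<open>1 - p\<close>. Both symbols have the same deletion probability \<open>p\<close>.
  The second argument of \<open>Pi_pmf\<close> is only the default value outside the index set.
\<close>

definition deletion_channel :: "real \<Rightarrow> bool list \<Rightarrow> bool list pmf" where
  "deletion_channel p x =
     map_pmf (\<lambda>K. nths x {i. K i}) (Pi_pmf {..<length x} False (\<lambda>_. bernoulli_pmf (1 - p)))"

definition traces :: "nat \<Rightarrow> real \<Rightarrow> bool list \<Rightarrow> bool list list pmf" where
  "traces m p x = replicate_pmf m (deletion_channel p x)"

text \<open>The maximal constant block occupying the positions \<open>{i..<j}\<close>; its length is \<open>j - i\<close>.\<close>

definition is_run :: "bool \<Rightarrow> bool list \<Rightarrow> nat \<Rightarrow> nat \<Rightarrow> bool" where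
  "is_run b x i j \<longleftrightarrow>
     i < j \<and> j \<le> length x \<and> (\<forall>k\<in>{i..<j}. x ! k = b) \<and>
     (i = 0 \<or> x ! (i - 1) \<noteq> b) \<and> (j = length x \<or> x ! j \<noteq> b)"

definition num_runs :: "bool list \<Rightarrow> nat" where
  "num_runs x = 1 + card {i. Suc i < length x \<and> x ! i \<noteq> x ! Suc i}"

definition zero_runs_ge :: "real \<Rightarrow> bool list \<Rightarrow> bool" where
  "zero_runs_ge l x \<longleftrightarrow> (\<forall>i j. is_run False x i j \<longrightarrow> l \<le> real (j - i))"

end

theory Submission
  imports Defs "HOL-Real_Asymp.Real_Asymp"
begin

text \<open>
  Record each one of \<open>x\<close> by the number of zeros before it. By hypothesis the resulting set of at most
  \<open>2 r\<close> points is separated by gaps \<open>\<ge> L\<close> with \<open>L\<close> of order \<open>r (ln n)\<^sup>2\<close>. In a trace a distance \<open>d\<close>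
  between surviving points becomes \<open>d/2\<close> up to \<open>ln n \<cdot> \<surd>d\<close>, with overwhelming probability.

  Cut the point set at all gaps \<open>\<ge> \<tau>\<close>. The blocks have diameter at most \<open>2 r \<tau>\<close> on either side
  of a point, and \<open>ln n \<cdot> \<surd>(r \<tau>)\<close> is far below \<open>\<tau>\<close> as soon as \<open>\<tau> \<ge> L\<close>. So for a point \<open>p\<close> the
  ends of its blocks for \<open>\<tau> = L, 2 L, 4 L, \<dots>\<close> form a pattern of \<open>O(log n)\<close> points which fits into
  the point set, up to the noise, only with \<open>p\<close> in its proper place. All points of the pattern survive with
  probability \<open>n\<^sup>-\<^sup>O\<^sup>(\<^sup>1\<^sup>)\<close>, so if the channel outputs of \<open>x\<close> and \<open>y\<close> are closer than a suitable
  power \<open>n\<^sup>-\<^sup>d\<close> in total variation, then small patterns of \<open>x\<close> fit into \<open>y\<close> and vice versa. This matches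
  the points of \<open>x\<close> and \<open>y\<close>. Once a pattern around a gap (or a block of ones) is found in the trace,
  the coins inside it are still independent of this event, and the first two moments of the number
  of survivors determine its exact length. Hence \<open>x = y\<close>.

  So the channel outputs of distinct admissible strings are told apart by some event with bias
  \<open>n\<^sup>-\<^sup>d\<close>, and by Hoeffding's inequality polynomially many traces suffice for all of the at most
  \<open>4\<^sup>n\<close> pairs at once.
\<close>

section \<open>Almost isometric maps between separated point sets\<close>

definition separated :: "real \<Rightarrow> nat set \<Rightarrow> bool" where
  "separated L X \<longleftrightarrow> (\<forall>s\<in>X. \<forall>s'\<in>X. s < s' \<longrightarrow> L \<le> real s' - real s)"

text \<open>The square-root error is the size of the fluctuations of a randomly thinned distance.
  Order is not part of the notion; it comes from separation (\<open>emb_less\<close>).\<close>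

definition emb :: "real \<Rightarrow> nat set \<Rightarrow> nat set \<Rightarrow> (nat \<Rightarrow> nat) \<Rightarrow> bool" where
  "emb c S Y g \<longleftrightarrow> g ` S \<subseteq> Y \<and> (\<forall>s\<in>S. \<forall>s'\<in>S.
     \<bar>(real (g s) - real (g s')) - (real s - real s')\<bar> \<le> c * sqrt \<bar>real s - real s'\<bar>)"

lemma embD:
  assumes "emb c S Y g" "s \<in> S" "s' \<in> S"
  shows "\<bar>(real (g s) - real (g s')) - (real s - real s')\<bar> \<le> c * sqrt \<bar>real s - real s'\<bar>"
  using assms by (auto simp: emb_def)

lemma emb_mem: "emb c S Y g \<Longrightarrow> s \<in> S \<Longrightarrow> g s \<in> Y"
  by (auto simp: emb_def)

lemma emb_mono:
  assumes "emb c S Y g" "T \<subseteq> S" "c \<le> d"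
  shows "emb d T Y g"
  unfolding emb_def
proof (intro conjI ballI)
  show "g ` T \<subseteq> Y" using assms by (auto simp: emb_def)
  fix s s' assume "s \<in> T" "s' \<in> T"
  then have "\<bar>(real (g s) - real (g s')) - (real s - real s')\<bar> \<le> c * sqrt \<bar>real s - real s'\<bar>"
    using assms by (auto intro: embD)
  also have "\<dots> \<le> d * sqrt \<bar>real s - real s'\<bar>"
    using assms(3) by (intro mult_right_mono) auto
  finally show "\<bar>(real (g s) - real (g s')) - (real s - real s')\<bar> \<le> d * sqrt \<bar>real s - real s'\<bar>" .
qed

lemma separatedD:
  assumes "separated L X" "s \<in> X" "s' \<in> X" "s \<noteq> s'"
  shows "L \<le> \<bar>real s - real s'\<bar>"
  using assms by (cases "s < s'") (force simp: separated_def)+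

lemma separated_subset: "separated L X \<Longrightarrow> S \<subseteq> X \<Longrightarrow> separated L S"
  by (auto simp: separated_def)

lemma mult_sqrt_le:
  fixes c d k :: real
  assumes "0 \<le> k" "0 \<le> d" "c\<^sup>2 \<le> k\<^sup>2 * d"
  shows "c * sqrt d \<le> k * d"
proof -
  have "c \<le> k * sqrt d"
  proof (rule power2_le_imp_le)
    have "(sqrt d)\<^sup>2 = d" using assms(2) by simp
    then show "c\<^sup>2 \<le> (k * sqrt d)\<^sup>2" using assms(3) by (simp only: power_mult_distrib)
  qed (use assms in simp)
  then have "c * sqrt d \<le> (k * sqrt d) * sqrt d" by (rule mult_right_mono) (use assms in simp)
  also have "\<dots> = k * d" using assms(2) by (simp add: mult.assoc)
  finally show ?thesis .
qed

text \<open>All distances are at least \<open>L\<close>, so \<open>c\<close> is below their square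
  roots and the error is strictly smaller than the distance itself.\<close>

lemma emb_less:
  assumes g: "emb c S Y g" and sep: "separated L S" and c: "0 \<le> c" "c\<^sup>2 < L"
    and s: "s \<in> S" "s' \<in> S" "s < s'"
  shows "g s < g s'"
proof -
  have d: "L \<le> real s' - real s" using sep s by (auto simp: separated_def)
  have "\<bar>(real (g s') - real (g s)) - (real s' - real s)\<bar> \<le> c * sqrt (real s' - real s)"
    using embD[OF g s(2,1)] s(3) by simp
  also have "\<dots> < real s' - real s"
  proof -
    have "0 < real s' - real s" using s by simp
    moreover have "c < sqrt (real s' - real s)"
      using c d by (intro real_less_rsqrt) auto
    ultimately have "c * sqrt (real s' - real s) < sqrt (real s' - real s) * sqrt (real s' - real s)"
      by (intro mult_strict_right_mono) auto
    then show ?thesis using s by simp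
  qed
  finally show ?thesis by linarith
qed

text \<open>Separation forces \<open>c * sqrt D \<le> 3 * D\<close>, so \<open>g\<close> stretches a
  distance \<open>D\<close> at most to \<open>4 * D\<close>. The error of \<open>h\<close> thus
  doubles when measured by \<open>sqrt D\<close>, which gives \<open>c + 2 * d\<close>.\<close>

lemma emb_comp:
  assumes g: "emb c S Y g" and h: "emb d T X h" and T: "g ` S \<subseteq> T" and sep: "separated L S"
    and c: "0 \<le> c" "0 \<le> d" "c\<^sup>2 \<le> 9 * L"
  shows "emb (c + 2 * d) S X (h \<circ> g)"
  unfolding emb_def
proof (intro conjI ballI)
  show "(h \<circ> g) ` S \<subseteq> X" using h T by (auto simp: emb_def)
next
  fix s s' assume s: "s \<in> S" "s' \<in> S"
  let ?D = "\<bar>real s - real s'\<bar>" and ?D' = "\<bar>real (g s) - real (g s')\<bar>"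
  have 1: "\<bar>(real (g s) - real (g s')) - (real s - real s')\<bar> \<le> c * sqrt ?D"
    using embD[OF g s] .
  have 2: "\<bar>(real (h (g s)) - real (h (g s'))) - (real (g s) - real (g s'))\<bar> \<le> d * sqrt ?D'"
    using embD[OF h, of "g s" "g s'"] T s by auto
  have "c * sqrt ?D \<le> 3 * ?D"
  proof (cases "s = s'")
    case False
    have "L \<le> ?D" using separatedD[OF sep s False] .
    then have "c\<^sup>2 \<le> 3\<^sup>2 * ?D" using c(3) by simp
    then show ?thesis by (intro mult_sqrt_le) simp_all
  qed simp
  then have "?D' \<le> 4 * ?D" using 1 by (smt (verit))
  then have "sqrt ?D' \<le> sqrt (4 * ?D)" by (rule real_sqrt_le_mono)
  then have "d * sqrt ?D' \<le> d * (2 * sqrt ?D)" using c by (intro mult_left_mono) (auto simp: real_sqrt_mult)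
  with 1 2 show "\<bar>(real ((h \<circ> g) s) - real ((h \<circ> g) s')) - (real s - real s')\<bar> \<le> (c + 2 * d) * sqrt ?D"
    by (simp add: algebra_simps)
qed

section \<open>Blocks of a separated set and patterns that pin a point\<close>

text \<open>Walk to the right as long as some further point lies closer than \<tau>. Every step uses
  up a point of \<open>X\<close>, which bounds the length of the walk.\<close>

lemma right_end:
  fixes X :: "nat set" and \<tau> :: real
  assumes "finite X" "p \<in> X" and that: "\<tau> > 0"
  shows "\<exists>v\<in>X. p \<le> v \<and> real v - real p \<le> real (card X) * \<tau> \<and> (\<forall>s\<in>X. v < s \<longrightarrow> real v + \<tau> \<le> real s)"
proof -
  have "\<exists>v\<in>X. p \<le> v \<and> real v - real p \<le> real (card (X \<inter> {p..})) * \<tau> \<and> (\<forall>s\<in>X. v < s \<longrightarrow> real v + \<tau> \<le> real s)"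
    using assms(1,2)
  proof (induction "card (X \<inter> {p..})" arbitrary: p rule: less_induct)
    case less
    show ?case
    proof (cases "\<forall>s\<in>X. p < s \<longrightarrow> real p + \<tau> \<le> real s")
      case True
      then show ?thesis using less.prems that by (intro bexI[of _ p]) auto
    next
      case False
      then obtain q where q: "q \<in> X" "p < q" "real q < real p + \<tau>" by force
      have "p \<in> X \<inter> {p..}" "p \<notin> X \<inter> {q..}" "X \<inter> {q..} \<subseteq> X \<inter> {p..}"
        using less.prems(2) q(2) by auto
      then have "X \<inter> {q..} \<subset> X \<inter> {p..}" by blast
      then have "card (X \<inter> {q..}) < card (X \<inter> {p..})"
        using \<open>finite X\<close> by (intro psubset_card_mono) auto
      from less.hyps[OF this \<open>finite X\<close> q(1)] obtain v where
        v: "v \<in> X" "q \<le> v" "real v - real q \<le> real (card (X \<inter> {q..})) * \<tau>" "\<forall>s\<in>X. v < s \<longrightarrow> real v + \<tau> \<le> real s"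
        by blast
      have "real v - real p \<le> (real (card (X \<inter> {q..})) + 1) * \<tau>"
        using v(3) q(3) by (simp add: algebra_simps)
      also have "\<dots> \<le> real (card (X \<inter> {p..})) * \<tau>"
        using \<open>card (X \<inter> {q..}) < card (X \<inter> {p..})\<close> that by (intro mult_right_mono) linarith+
      finally show ?thesis using v q by (intro bexI[of _ v]) auto
    qed
  qed
  moreover have "real (card (X \<inter> {p..})) * \<tau> \<le> real (card X) * \<tau>"
    using that card_mono[OF assms(1), of "X \<inter> {p..}"] by (intro mult_right_mono) auto
  ultimately show ?thesis by (meson order_trans)
qed

lemma left_end:
  fixes X :: "nat set" and \<tau> :: real
  assumes "finite X" "p \<in> X" and that: "\<tau> > 0"
  shows "\<exists>v\<in>X. v \<le> p \<and> real p - real v \<le> real (card X) * \<tau> \<and> (\<forall>s\<in>X. s < v \<longrightarrow> real s + \<tau> \<le> real v)"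
proof -
  have "\<exists>v\<in>X. v \<le> p \<and> real p - real v \<le> real (card (X \<inter> {..p})) * \<tau> \<and> (\<forall>s\<in>X. s < v \<longrightarrow> real s + \<tau> \<le> real v)"
    using assms(1,2)
  proof (induction "card (X \<inter> {..p})" arbitrary: p rule: less_induct)
    case less
    show ?case
    proof (cases "\<forall>s\<in>X. s < p \<longrightarrow> real s + \<tau> \<le> real p")
      case True
      then show ?thesis using less.prems that by (intro bexI[of _ p]) auto
    next
      case False
      then obtain q where q: "q \<in> X" "q < p" "real p < real q + \<tau>" by force
      have "p \<in> X \<inter> {..p}" "p \<notin> X \<inter> {..q}" "X \<inter> {..q} \<subseteq> X \<inter> {..p}"
        using less.prems(2) q(2) by auto
      then have "X \<inter> {..q} \<subset> X \<inter> {..p}" by blast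
      then have "card (X \<inter> {..q}) < card (X \<inter> {..p})"
        using \<open>finite X\<close> by (intro psubset_card_mono) auto
      from less.hyps[OF this \<open>finite X\<close> q(1)] obtain v where
        v: "v \<in> X" "v \<le> q" "real q - real v \<le> real (card (X \<inter> {..q})) * \<tau>" "\<forall>s\<in>X. s < v \<longrightarrow> real s + \<tau> \<le> real v"
        by blast
      have "real p - real v \<le> (real (card (X \<inter> {..q})) + 1) * \<tau>"
        using v(3) q(3) by (simp add: algebra_simps)
      also have "\<dots> \<le> real (card (X \<inter> {..p})) * \<tau>"
        using \<open>card (X \<inter> {..q}) < card (X \<inter> {..p})\<close> that by (intro mult_right_mono) linarith+
      finally show ?thesis using v q by (intro bexI[of _ v]) auto
    qed
  qed
  moreover have "real (card (X \<inter> {..p})) * \<tau> \<le> real (card X) * \<tau>"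
    using that card_mono[OF assms(1), of "X \<inter> {..p}"] by (intro mult_right_mono) auto
  ultimately show ?thesis by (meson order_trans)
qed

text \<open>\<open>u\<close> and \<open>v\<close> are the ends of the block of \<open>p\<close> when \<open>X\<close> is cut at all gaps of length \<open>\<ge> \<tau>\<close>.
  A map that moves \<open>p\<close> by less than half of such a gap cannot carry \<open>u\<close> or \<open>v\<close> out of the
  block, and then \<open>p\<close> is pinned from both sides at the precision of the block diameter.\<close>

lemma localize_step:
  fixes \<tau> c :: real
  assumes X: "finite X" "p \<in> X" and c: "0 \<le> c" "36 * c\<^sup>2 * real (card X) \<le> \<tau>" "\<tau> > 0"
  obtains u v where "u \<in> X" "v \<in> X"
    "\<And>S g. emb c S X g \<Longrightarrow> {u, v, p} \<subseteq> S \<Longrightarrow> \<bar>real (g p) - real p\<bar> \<le> \<tau> / 3 \<Longrightarrow>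
       \<bar>real (g p) - real p\<bar> \<le> \<tau> / 6"
proof -
  from right_end[OF X \<open>\<tau> > 0\<close>] obtain v where v: "v \<in> X" "p \<le> v"
    "real v - real p \<le> real (card X) * \<tau>" "\<forall>s\<in>X. v < s \<longrightarrow> real v + \<tau> \<le> real s" by blast
  from left_end[OF X \<open>\<tau> > 0\<close>] obtain u where u: "u \<in> X" "u \<le> p"
    "real p - real u \<le> real (card X) * \<tau>" "\<forall>s\<in>X. s < u \<longrightarrow> real s + \<tau> \<le> real u" by blast
  \<comment> \<open>The lower bound on \<tau> serves this purpose: over distances within the block
    the noise is at most a sixth of \<tau>.\<close>
  have small: "c * sqrt d \<le> \<tau> / 6" if "0 \<le> d" "d \<le> real (card X) * \<tau>" for d
  proof (rule power2_le_imp_le)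
    have "(c * sqrt d)\<^sup>2 = c\<^sup>2 * d" using that by (simp add: power_mult_distrib)
    also have "\<dots> \<le> c\<^sup>2 * (real (card X) * \<tau>)" using that by (intro mult_left_mono) auto
    also have "\<dots> \<le> (\<tau> / 36) * \<tau>" using c mult_right_mono[OF c(2), of "\<tau> / 36"] by (simp add: field_simps)
    finally show "(c * sqrt d)\<^sup>2 \<le> (\<tau> / 6)\<^sup>2" by (simp add: power2_eq_square)
  qed (use c in auto)
  have "\<bar>real (g p) - real p\<bar> \<le> \<tau> / 6"
    if g: "emb c S X g" and S: "{u, v, p} \<subseteq> S" and near: "\<bar>real (g p) - real p\<bar> \<le> \<tau> / 3" for S g
  proof -
    have gu: "g u \<in> X" and gv: "g v \<in> X" using emb_mem[OF g] S by auto
    have 1: "\<bar>(real (g v) - real (g p)) - (real v - real p)\<bar> \<le> \<tau> / 6"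
      using embD[OF g, of v p] S small[of "real v - real p"] v by force
    have 2: "\<bar>(real (g p) - real (g u)) - (real p - real u)\<bar> \<le> \<tau> / 6"
      using embD[OF g, of p u] S small[of "real p - real u"] u by force
    \<comment> \<open>The shift of \<open>p\<close> is at most \<tau>/3 and its distance to
      \<open>v\<close> changes by at most \<tau>/6. So \<open>v\<close> moves right by at most
      \<tau>/2, too little to cross the gap behind it.\<close>
    have "g v \<le> v"
    proof (rule ccontr)
      assume "\<not> g v \<le> v"
      then have "real v + \<tau> \<le> real (g v)" using v(4) gv by auto
      then show False using 1 near c(3) by (auto simp: abs_le_iff)
    qed
    moreover have "u \<le> g u"
    proof (rule ccontr)
      assume "\<not> u \<le> g u"
      then have "real (g u) + \<tau> \<le> real u" using u(4) gu by auto
      then show False using 2 near c(3) by (auto simp: abs_le_iff)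
    qed
    ultimately show ?thesis using 1 2 by linarith
  qed
  with u v show ?thesis using that by blast
qed

text \<open>Descending induction over the scales \<open>2 ^ l * L\<close>. At \<open>l = h\<close>
  the bound is trivial because displacements are at most \<open>n\<close>. Each step adds the two
  block ends of one scale and halves the bound. At \<open>l = 0\<close> the displacement is below
  the separation, hence zero.\<close>

lemma rigid_set:
  fixes c L :: real
  assumes X: "finite X" "X \<subseteq> {..n}" "p \<in> X" and sep: "separated L X"
    and c: "0 \<le> c" "36 * c\<^sup>2 * real (card X) \<le> L" "1 \<le> L" and h: "3 * n \<le> 2 ^ h"
  shows "\<exists>S. S \<subseteq> X \<and> p \<in> S \<and> card S \<le> 2 * h + 1 \<and> (\<forall>g. emb c S X g \<longrightarrow> g p = p)"
proof -
  have "\<exists>S. S \<subseteq> X \<and> p \<in> S \<and> card S \<le> 2 * (h - l) + 1 \<and>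
      (\<forall>g. emb c S X g \<longrightarrow> \<bar>real (g p) - real p\<bar> \<le> 2 ^ l * L / 3)" if "l \<le> h" for l
    using that
  proof (induction l rule: inc_induct)
    case base
    have "\<bar>real (g p) - real p\<bar> \<le> 2 ^ h * L / 3" if "emb c {p} X g" for g
    proof -
      have "g p \<in> X" using that by (auto simp: emb_def)
      then have "g p \<le> n" "p \<le> n" using X by auto
      then have "\<bar>real (g p) - real p\<bar> \<le> real n" by linarith
      also have "\<dots> \<le> 2 ^ h * 1 / 3"
      proof -
        have "real (3 * n) \<le> real (2 ^ h)" using h by (simp only: of_nat_le_iff)
        then show ?thesis by simp
      qed
      also have "\<dots> \<le> 2 ^ h * L / 3" using c(3) by (intro divide_right_mono mult_left_mono) auto
      finally show ?thesis .
    qed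
    then have "{p} \<subseteq> X \<and> p \<in> {p} \<and> card {p} \<le> 2 * (h - h) + 1 \<and>
      (\<forall>g. emb c {p} X g \<longrightarrow> \<bar>real (g p) - real p\<bar> \<le> 2 ^ h * L / 3)"
      using X(3) by simp
    then show ?case by blast
  next
    case (step l)
    then obtain S where S: "S \<subseteq> X" "p \<in> S" "card S \<le> 2 * (h - Suc l) + 1"
      "\<And>g. emb c S X g \<Longrightarrow> \<bar>real (g p) - real p\<bar> \<le> 2 ^ Suc l * L / 3" by blast
    \<comment> \<open>At this scale the bound \<open>?t / 3\<close> of the induction hypothesis
      improves to \<open>?t / 6\<close>, which is the bound claimed for \<open>l\<close>.\<close>
    let ?t = "2 ^ Suc l * L"
    have "L \<le> ?t" using c(3) mult_right_mono[of 1 "2 ^ Suc l" L] one_le_power[of "2::real" "Suc l"]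
      by (simp del: power_Suc)
    obtain u v where uv: "u \<in> X" "v \<in> X"
      "\<And>S g. emb c S X g \<Longrightarrow> {u, v, p} \<subseteq> S \<Longrightarrow> \<bar>real (g p) - real p\<bar> \<le> ?t / 3 \<Longrightarrow>
        \<bar>real (g p) - real p\<bar> \<le> ?t / 6"
    proof (rule localize_step[OF X(1,3) c(1), of ?t])
      show "36 * c\<^sup>2 * real (card X) \<le> ?t" "0 < ?t" using c \<open>L \<le> ?t\<close> by linarith+
    qed blast
    have "finite S" using S X finite_subset by blast
    have "card (insert u (insert v S)) \<le> card S + 2"
      by (simp add: card_insert_if \<open>finite S\<close>)
    then have "card (insert u (insert v S)) \<le> 2 * (h - l) + 1" using S(3) step.hyps by linarith
    moreover have "\<bar>real (g p) - real p\<bar> \<le> 2 ^ l * L / 3" if g: "emb c (insert u (insert v S)) X g" for g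
    proof -
      have "emb c S X g" using g by (rule emb_mono) auto
      from uv(3)[OF g _ S(4)[OF this]] S(2) have "\<bar>real (g p) - real p\<bar> \<le> ?t / 6" by blast
      then show ?thesis by (simp add: mult.commute)
    qed
    moreover have "insert u (insert v S) \<subseteq> X" "p \<in> insert u (insert v S)" using S uv by auto
    ultimately show ?case by blast
  qed
  from this[OF le0] obtain S where S: "S \<subseteq> X" "p \<in> S" "card S \<le> 2 * (h - 0) + 1"
      "\<And>g. emb c S X g \<Longrightarrow> \<bar>real (g p) - real p\<bar> \<le> 2 ^ 0 * L / 3" by blast
  have "card S \<le> 2 * h + 1" using S(3) by simp
  have "g p = p" if "emb c S X g" for g
  proof (rule ccontr)
    assume "g p \<noteq> p"
    then have "L \<le> \<bar>real (g p) - real p\<bar>"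
      using separatedD[OF sep emb_mem[OF that S(2)] X(3)] by blast
    then show False using S(4)[OF that] c(3) by simp
  qed
  then show ?thesis using S(1,2) \<open>card S \<le> 2 * h + 1\<close> by blast
qed

section \<open>Independent fair coins\<close>

definition coins :: "nat \<Rightarrow> (nat \<Rightarrow> bool) pmf" where
  "coins n = Pi_pmf {..<n} False (\<lambda>_. bernoulli_pmf (1/2))"

text \<open>The coins are uniform on a finite set of functions, and flipping one entry permutes this
  set.\<close>

lemma coins_flip:
  assumes "e < n"
  shows "map_pmf (\<lambda>K. K(e := \<not> K e)) (coins n) = coins n"
proof -
  let ?A = "PiE_dflt {..<n} False (\<lambda>_. UNIV :: bool set)"
  have c: "coins n = pmf_of_set ?A"
    unfolding coins_def bernoulli_pmf_half_conv_pmf_of_set by (rule Pi_pmf_of_set) auto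
  have "bij_betw (\<lambda>K. K(e := \<not> K e)) ?A ?A"
    by (rule bij_betwI[of _ _ _ "\<lambda>K. K(e := \<not> K e)"]) (use assms in \<open>auto simp: PiE_dflt_def\<close>)
  then show ?thesis unfolding c by (intro map_pmf_of_set_bij_betw) auto
qed

text \<open>Invariance of \<open>B\<close> under changing the coin \<open>e\<close> is the form in
  which independence is used throughout.\<close>

lemma prob_and_bit:
  assumes "e < n" "\<And>K b. B (K(e := b)) = B K"
  shows "measure_pmf.prob (coins n) {K. B K \<and> K e} = measure_pmf.prob (coins n) {K. B K} / 2"
proof -
  let ?P = "measure_pmf.prob (coins n)"
  have "?P {K. B K \<and> K e} = measure_pmf.prob (map_pmf (\<lambda>K. K(e := \<not> K e)) (coins n)) {K. B K \<and> K e}"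
    by (simp add: coins_flip[OF assms(1)])
  also have "\<dots> = ?P {K. B K \<and> \<not> K e}"
    by (simp add: assms(2))
  finally have 1: "?P {K. B K \<and> K e} = ?P {K. B K \<and> \<not> K e}" .
  have "?P ({K. B K \<and> K e} \<union> {K. B K \<and> \<not> K e}) = ?P {K. B K \<and> K e} + ?P {K. B K \<and> \<not> K e}"
    by (rule measure_pmf.finite_measure_Union) auto
  moreover have "{K. B K \<and> K e} \<union> {K. B K \<and> \<not> K e} = {K. B K}" by auto
  ultimately show ?thesis using 1 by simp
qed

lemma expectation_card_eq_sum:
  assumes "finite W"
  shows "measure_pmf.expectation (coins n) (\<lambda>K. if B K then real (card {e\<in>W. K e}) else 0) =
    (\<Sum>e\<in>W. measure_pmf.prob (coins n) {K. B K \<and> K e})"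
proof -
  have "(if B K then real (card {e\<in>W. K e}) else 0) = (\<Sum>e\<in>W. indicator {K. B K \<and> K e} K)" for K
  proof -
    have "real (card {e\<in>W. K e}) = (\<Sum>e\<in>W. of_bool (K e))" using assms by (simp add: sum.If_cases of_bool_def Int_def)
    then show ?thesis by (auto simp: indicator_def of_bool_def)
  qed
  then have "measure_pmf.expectation (coins n) (\<lambda>K. if B K then real (card {e\<in>W. K e}) else 0) =
     measure_pmf.expectation (coins n) (\<lambda>K. \<Sum>e\<in>W. indicator {K. B K \<and> K e} K)" by simp
  also have "\<dots> = (\<Sum>e\<in>W. measure_pmf.expectation (coins n) (indicator {K. B K \<and> K e}))"
    by (rule Bochner_Integration.integral_sum) (auto intro!: measure_pmf.integrable_const_bound[where B=1])
  finally show ?thesis by simp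
qed

lemma expectation_card:
  assumes "W \<subseteq> {..<n}" "\<And>K e b. e \<in> W \<Longrightarrow> B (K(e := b)) = B K"
  shows "measure_pmf.expectation (coins n) (\<lambda>K. if B K then real (card {e\<in>W. K e}) else 0) =
    real (card W) / 2 * measure_pmf.prob (coins n) {K. B K}"
proof -
  have "finite W" using assms(1) finite_subset by blast
  have "(\<Sum>e\<in>W. measure_pmf.prob (coins n) {K. B K \<and> K e}) = (\<Sum>e\<in>W. measure_pmf.prob (coins n) {K. B K} / 2)"
    using assms by (intro sum.cong prob_and_bit) auto
  with expectation_card_eq_sum[OF \<open>finite W\<close>, of n B] show ?thesis by simp
qed

text \<open>The square is a sum over the heads \<open>e\<close> of the number of heads. With
  \<open>P\<close> the probability of \<open>B\<close>, a fixed \<open>e\<close> contributes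
  \<open>P / 2\<close> from \<open>e' = e\<close> and \<open>P / 4\<close> from every other
  \<open>e'\<close>.\<close>

lemma expectation_card_square:
  assumes "W \<subseteq> {..<n}" "\<And>K e b. e \<in> W \<Longrightarrow> B (K(e := b)) = B K"
  shows "measure_pmf.expectation (coins n) (\<lambda>K. if B K then (real (card {e\<in>W. K e}))\<^sup>2 else 0) =
    ((real (card W))\<^sup>2 + real (card W)) / 4 * measure_pmf.prob (coins n) {K. B K}"
proof -
  let ?E = "measure_pmf.expectation (coins n)" and ?P = "measure_pmf.prob (coins n)"
  have fin: "finite W" using assms(1) finite_subset by blast
  have eq: "(if B K then (real (card {e\<in>W. K e}))\<^sup>2 else 0) =
      (\<Sum>e\<in>W. if B K \<and> K e then real (card {e\<in>W. K e}) else 0)" for K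
  proof -
    have "(\<Sum>e\<in>W. if B K \<and> K e then real (card {e\<in>W. K e}) else 0) =
        (\<Sum>e\<in>{e\<in>W. K e}. if B K then real (card {e\<in>W. K e}) else 0)"
      by (rule sum.mono_neutral_cong_right) (use fin in auto)
    then show ?thesis by (auto simp: power2_eq_square)
  qed
  have int: "integrable (coins n) (\<lambda>K. if B K \<and> K e then real (card {e\<in>W. K e}) else 0)" for e
    by (rule measure_pmf.integrable_const_bound[where B="real (card W)"])
       (auto intro!: card_mono fin)
  have one: "?E (\<lambda>K. if B K \<and> K e then real (card {e\<in>W. K e}) else 0) = (real (card W) + 1) / 4 * ?P {K. B K}"
    if e: "e \<in> W" for e
  proof -
    have en: "e < n" using e assms(1) by auto
    have "(\<Sum>e'\<in>W. ?P {K. (B K \<and> K e) \<and> K e'}) = ?P {K. (B K \<and> K e) \<and> K e} + (\<Sum>e'\<in>W-{e}. ?P {K. (B K \<and> K e) \<and> K e'})"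
      by (rule sum.remove) (use fin e in auto)
    also have "(\<Sum>e'\<in>W-{e}. ?P {K. (B K \<and> K e) \<and> K e'}) = (\<Sum>e'\<in>W-{e}. ?P {K. B K \<and> K e} / 2)"
      by (intro sum.cong refl prob_and_bit) (use assms in auto)
    also have "?P {K. B K \<and> K e} = ?P {K. B K} / 2"
      using en assms(2)[OF e] by (intro prob_and_bit)
    also have "{K. (B K \<and> K e) \<and> K e} = {K. B K \<and> K e}" by auto
    also have "?P {K. B K \<and> K e} = ?P {K. B K} / 2"
      using en assms(2)[OF e] by (intro prob_and_bit)
    finally have "(\<Sum>e'\<in>W. ?P {K. (B K \<and> K e) \<and> K e'}) = ?P {K. B K} / 2 + real (card (W - {e})) * (?P {K. B K} / 4)"
      by simp
    moreover have "real (card (W - {e})) = real (card W) - 1"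
      using fin e by (simp add: of_nat_diff Suc_leI card_gt_0_iff) (metis card_gt_0_iff empty_iff Suc_leI One_nat_def of_nat_diff of_nat_1)
    ultimately show ?thesis
      using expectation_card_eq_sum[OF fin, of n "\<lambda>K. B K \<and> K e"] by (simp add: field_simps)
  qed
  have "?E (\<lambda>K. if B K then (real (card {e\<in>W. K e}))\<^sup>2 else 0) =
    (\<Sum>e\<in>W. ?E (\<lambda>K. if B K \<and> K e then real (card {e\<in>W. K e}) else 0))"
    unfolding eq by (rule Bochner_Integration.integral_sum) (rule int)
  also have "\<dots> = (\<Sum>e\<in>W. (real (card W) + 1) / 4 * ?P {K. B K})"
    by (intro sum.cong one refl)
  finally show ?thesis by (simp add: field_simps power2_eq_square)
qed

lemma prob_all_heads:
  assumes "E \<subseteq> {..<n}"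
  shows "measure_pmf.prob (coins n) {K. \<forall>e\<in>E. K e} = (1/2) ^ card E"
proof -
  have fin: "finite E" using assms finite_subset by blast
  have "measure_pmf.prob (coins n) {K. \<forall>e\<in>E. K e} =
      measure_pmf.prob (coins n) (PiE_dflt {..<n} False (\<lambda>e. if e \<in> E then {True} else UNIV))"
    unfolding coins_def using assms
    by (intro measure_prob_cong_0) (auto simp: PiE_dflt_def pmf_Pi split: if_splits)
  also have "\<dots> = (\<Prod>e<n. measure_pmf.prob (bernoulli_pmf (1/2)) (if e \<in> E then {True} else UNIV))"
    unfolding coins_def by (rule measure_Pi_pmf_PiE_dflt) simp
  also have "\<dots> = (\<Prod>e<n. if e \<in> E then 1/2 else 1)"
    by (intro prod.cong) (auto simp: measure_pmf_single)
  also have "\<dots> = (\<Prod>e\<in>E. 1/2)"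
    using assms by (intro prod.mono_neutral_cong_right) auto
  finally show ?thesis by simp
qed

text \<open>The number of heads in \<open>W\<close> is binomial, so this is Hoeffding's
  inequality.\<close>

lemma coins_deviation:
  assumes "W \<subseteq> {..<n}" "W \<noteq> {}" "\<epsilon> \<ge> 0"
  shows "measure_pmf.prob (coins n) {K. \<epsilon> \<le> \<bar>real (card {e\<in>W. K e}) - real (card W) / 2\<bar>}
    \<le> 2 * exp (- 2 * \<epsilon>\<^sup>2 / real (card W))"
proof -
  have fin: "finite W" using assms finite_subset by blast
  have "binomial_pmf (card W) (1/2) = map_pmf (\<lambda>K. card {e\<in>W. K e}) (Pi_pmf W False (\<lambda>_. bernoulli_pmf (1/2)))"
    by (rule binomial_pmf_altdef') (use fin in auto)
  also have "\<dots> = map_pmf (\<lambda>K. card {e\<in>W. K e}) (coins n)"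
    unfolding coins_def by (subst Pi_pmf_subset[OF _ assms(1)])
      (auto simp: pmf.map_comp o_def intro!: pmf.map_cong arg_cong[where f=card])
  finally have "measure_pmf.prob (coins n) {K. \<epsilon> \<le> \<bar>real (card {e\<in>W. K e}) - real (card W) / 2\<bar>} =
    measure_pmf.prob (binomial_pmf (card W) (1/2)) {k. \<bar>real k - real (card W) * (1/2)\<bar> \<ge> \<epsilon>}" by simp
  also have "\<dots> \<le> 2 * exp (- 2 * \<epsilon>\<^sup>2 / real (card W))"
    by (rule binomial_distribution.prob_abs_ge) (use assms fin in \<open>auto simp: binomial_distribution_def card_gt_0_iff\<close>)
  finally show ?thesis .
qed

text \<open>The expectation of \<open>f\<close> is the sum of the probabilities of
  \<open>j < f t\<close> over \<open>j < b\<close>, and each summand changes by at most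
  \<eta>.\<close>

lemma expectation_close:
  fixes p q :: "'a pmf" and f :: "'a \<Rightarrow> nat"
  assumes "\<And>A. \<bar>measure_pmf.prob p A - measure_pmf.prob q A\<bar> \<le> \<eta>" "\<And>t. f t \<le> b"
  shows "\<bar>measure_pmf.expectation p (\<lambda>t. real (f t)) - measure_pmf.expectation q (\<lambda>t. real (f t))\<bar> \<le> real b * \<eta>"
proof -
  have eq: "real (f t) = (\<Sum>j<b. indicator {t. j < f t} t)" for t
  proof -
    have "(\<Sum>j<b. indicator {t. j < f t} t) = (\<Sum>j\<in>{..<f t}. 1 :: real)"
      using assms(2)[of t] by (intro sum.mono_neutral_cong_right) (auto simp: indicator_def)
    then show ?thesis by simp
  qed
  have E: "measure_pmf.expectation p (\<lambda>t. real (f t)) = (\<Sum>j<b. measure_pmf.prob p {t. j < f t})" for p :: "'a pmf"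
  proof -
    have "measure_pmf.expectation p (\<lambda>t. real (f t)) = (\<Sum>j<b. measure_pmf.expectation p (indicator {t. j < f t}))"
      unfolding eq by (rule Bochner_Integration.integral_sum) (auto intro!: measure_pmf.integrable_const_bound[where B=1])
    then show ?thesis by simp
  qed
  have "\<bar>(\<Sum>j<b. measure_pmf.prob p {t. j < f t} - measure_pmf.prob q {t. j < f t})\<bar> \<le> (\<Sum>j<b. \<eta>)"
    by (rule order_trans[OF sum_abs sum_mono]) (rule assms(1))
  then show ?thesis unfolding E by (simp add: sum_subtractf)
qed

lemma expectation_cong_event:
  fixes p :: "'a pmf" and f g :: "'a \<Rightarrow> real"
  assumes "\<And>t. G t \<Longrightarrow> f t = g t" "\<And>t. 0 \<le> f t \<and> f t \<le> b" "\<And>t. 0 \<le> g t \<and> g t \<le> b"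
  shows "\<bar>measure_pmf.expectation p f - measure_pmf.expectation p g\<bar> \<le> b * measure_pmf.prob p {t. \<not> G t}"
proof -
  have int: "integrable p f" "integrable p g"
    by (rule measure_pmf.integrable_const_bound[where B=b]; use assms in force)+
  have "\<bar>measure_pmf.expectation p f - measure_pmf.expectation p g\<bar> = \<bar>measure_pmf.expectation p (\<lambda>t. f t - g t)\<bar>"
    using int by simp
  also have "\<dots> \<le> measure_pmf.expectation p (\<lambda>t. \<bar>f t - g t\<bar>)" by (rule integral_abs_bound)
  also have "\<dots> \<le> measure_pmf.expectation p (\<lambda>t. b * indicator {t. \<not> G t} t)"
  proof (rule integral_mono)
    show "\<bar>f t - g t\<bar> \<le> b * indicator {t. \<not> G t} t" for t
      using assms(1)[of t] assms(2,3)[of t] by (cases "G t") (auto simp: indicator_def)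
    have "integrable p (indicator {t. \<not> G t} :: 'a \<Rightarrow> real)"
      by (rule measure_pmf.integrable_const_bound[where B=1]) auto
    then show "integrable p (\<lambda>t. b * indicator {t. \<not> G t} t)" by (rule integrable_mult_right)
  qed (use int in auto)
  finally show ?thesis by simp
qed

section \<open>Points of a string and of its traces\<close>

definition zc :: "bool list \<Rightarrow> nat \<Rightarrow> nat" where
  "zc x i = card {k. k < i \<and> \<not> x ! k}"

text \<open>The index \<open>s\<close> numbers the slots before, between and behind the zeros; the
  value is the length, possibly 0, of the block of ones in that slot.\<close>

definition ones_at :: "bool list \<Rightarrow> nat \<Rightarrow> nat" where
  "ones_at x s = card {e. e < length x \<and> x ! e \<and> zc x e = s}"

text \<open>Points are numbers of preceding zeros; both ends of the string count as points that cannot be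
  deleted, even if no one sits there.\<close>

definition pts :: "bool list \<Rightarrow> nat set" where
  "pts x = {0, zc x (length x)} \<union> {zc x e | e. e < length x \<and> x ! e}"

definition zseg :: "bool list \<Rightarrow> nat \<Rightarrow> nat \<Rightarrow> nat set" where
  "zseg x a b = {k. k < length x \<and> \<not> x ! k \<and> a \<le> zc x k \<and> zc x k < b}"

text \<open>The place of the point \<open>s\<close> in the trace kept by \<open>K\<close>, namely
  the number of surviving zeros in front of it.\<close>

definition theta :: "bool list \<Rightarrow> (nat \<Rightarrow> bool) \<Rightarrow> nat \<Rightarrow> nat" where
  "theta x K s = card {k \<in> zseg x 0 s. K k}"

definition alive :: "bool list \<Rightarrow> (nat \<Rightarrow> bool) \<Rightarrow> nat \<Rightarrow> bool" where
  "alive x K s \<longleftrightarrow> s = 0 \<or> s = zc x (length x) \<or> (\<exists>e<length x. x ! e \<and> K e \<and> zc x e = s)"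

abbreviation thin :: "bool list \<Rightarrow> (nat \<Rightarrow> bool) \<Rightarrow> bool list" where
  "thin x K \<equiv> nths x {i. K i}"

lemma zc_Suc: "zc x (Suc i) = zc x i + (if x ! i then 0 else 1)"
proof -
  have "{k. k < Suc i \<and> \<not> x ! k} = {k. k < i \<and> \<not> x ! k} \<union> (if x ! i then {} else {i})"
    by (auto simp: less_Suc_eq)
  then show ?thesis by (auto simp: zc_def)
qed

lemma zc_0 [simp]: "zc x 0 = 0" by (simp add: zc_def)

lemma zc_mono: "i \<le> j \<Longrightarrow> zc x i \<le> zc x j"
  unfolding zc_def by (rule card_mono) auto

lemma zc_less: "k < j \<Longrightarrow> \<not> x ! k \<Longrightarrow> zc x k < zc x j"
  using zc_mono[of "Suc k" j x] by (simp add: zc_Suc)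

lemma zc_less_iff: "\<not> x ! k \<Longrightarrow> zc x k < zc x j \<longleftrightarrow> k < j"
  using zc_less[of k j x] zc_mono[of j k x] by (cases "k < j") auto

lemma zc_le: "zc x i \<le> i"
  using card_mono[of "{..<i}" "{k. k < i \<and> \<not> x ! k}"] by (auto simp: zc_def)

lemma zc_append: "i \<le> length x \<Longrightarrow> zc (x @ y) i = zc x i"
  unfolding zc_def by (rule arg_cong[where f=card]) (auto simp: nth_append)

lemma pts_finite [simp]: "finite (pts x)"
proof -
  have "{zc x e | e. e < length x \<and> x ! e} \<subseteq> zc x ` {..<length x}" by auto
  then show ?thesis unfolding pts_def by (auto intro: finite_subset)
qed

lemma pts_le: "s \<in> pts x \<Longrightarrow> s \<le> zc x (length x)"
  unfolding pts_def by (auto intro: zc_mono)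

lemma pts_le_length: "pts x \<subseteq> {..length x}"
  by (meson atMost_iff order_trans pts_le subsetI zc_le)

lemma pts_iff: "s \<in> pts x \<longleftrightarrow> s = 0 \<or> s = zc x (length x) \<or> 0 < ones_at x s"
proof -
  have "finite {e. e < length x \<and> x ! e \<and> zc x e = s}" by simp
  then have "0 < ones_at x s \<longleftrightarrow> {e. e < length x \<and> x ! e \<and> zc x e = s} \<noteq> {}"
    unfolding ones_at_def card_gt_0_iff by blast
  then show ?thesis by (auto simp: pts_def)
qed

lemma ones_at_snoc: "ones_at (t @ [a]) s = ones_at t s + (if a \<and> s = zc t (length t) then 1 else 0)"
proof -
  have "{e. e < length (t @ [a]) \<and> (t @ [a]) ! e \<and> zc (t @ [a]) e = s} =
    {e. e < length t \<and> t ! e \<and> zc t e = s} \<union> (if a \<and> s = zc t (length t) then {length t} else {})"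
    by (auto simp: nth_append less_Suc_eq zc_append)
  then show ?thesis unfolding ones_at_def by (auto simp: card_Un_disjoint)
qed

lemma zc_snoc: "zc (t @ [a]) (Suc (length t)) = zc t (length t) + (if a then 0 else 1)"
  by (simp add: zc_Suc zc_append)

lemma thin_snoc: "thin (x @ [a]) K = thin x K @ (if K (length x) then [a] else [])"
  by (simp add: nths_append)

lemma thin_total: "zc (thin x K) (length (thin x K)) = card {k. k < length x \<and> \<not> x ! k \<and> K k}"
proof (induction x rule: rev_induct)
  case (snoc a x)
  have "{k. k < length (x @ [a]) \<and> \<not> (x @ [a]) ! k \<and> K k} =
    {k. k < length x \<and> \<not> x ! k \<and> K k} \<union> (if K (length x) \<and> \<not> a then {length x} else {})"
    by (auto simp: nth_append less_Suc_eq)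
  then have "card {k. k < length (x @ [a]) \<and> \<not> (x @ [a]) ! k \<and> K k} =
    card {k. k < length x \<and> \<not> x ! k \<and> K k} + (if K (length x) \<and> \<not> a then 1 else 0)" by simp
  then show ?case by (simp add: thin_snoc zc_snoc snoc)
qed simp

lemma thin_ones_at_aux:
  "ones_at (thin x K) w = card {e. e < length x \<and> x ! e \<and> K e \<and> card {k. k < e \<and> \<not> x ! k \<and> K k} = w}"
proof (induction x rule: rev_induct)
  case (snoc a x)
  have *: "card {k. k < e \<and> \<not> (x @ [a]) ! k \<and> K k} = card {k. k < e \<and> \<not> x ! k \<and> K k}" if "e \<le> length x" for e
    by (rule arg_cong[where f=card]) (use that in \<open>auto simp: nth_append\<close>)
  have nx: "(x @ [a]) ! e = x ! e" if "e < length x" for e using that by (simp add: nth_append)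
  have "{e. e < length (x @ [a]) \<and> (x @ [a]) ! e \<and> K e \<and> card {k. k < e \<and> \<not> (x @ [a]) ! k \<and> K k} = w} =
    {e. e < length x \<and> x ! e \<and> K e \<and> card {k. k < e \<and> \<not> x ! k \<and> K k} = w} \<union>
    (if a \<and> K (length x) \<and> w = card {k. k < length x \<and> \<not> x ! k \<and> K k} then {length x} else {})"
    (is "?L = ?R")
  proof (rule set_eqI)
    fix e
    consider "e < length x" | "e = length x" | "length x < e" by linarith
    then show "e \<in> ?L \<longleftrightarrow> e \<in> ?R"
    proof cases
      case 1
      then show ?thesis using *[of e] nx[of e] by simp
    next
      case 2
      then show ?thesis using *[of e] by auto
    qed simp
  qed
  then have "card {e. e < length (x @ [a]) \<and> (x @ [a]) ! e \<and> K e \<and> card {k. k < e \<and> \<not> (x @ [a]) ! k \<and> K k} = w} =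
    card {e. e < length x \<and> x ! e \<and> K e \<and> card {k. k < e \<and> \<not> x ! k \<and> K k} = w} +
    (if a \<and> K (length x) \<and> w = card {k. k < length x \<and> \<not> x ! k \<and> K k} then 1 else 0)" by simp
  moreover have "ones_at (thin (x @ [a]) K) w = ones_at (thin x K) w +
      (if a \<and> K (length x) \<and> w = card {k. k < length x \<and> \<not> x ! k \<and> K k} then 1 else 0)"
    by (simp add: thin_snoc ones_at_snoc thin_total)
  ultimately show ?case using snoc by simp
qed (simp add: ones_at_def)

lemma zseg_finite [simp]: "finite (zseg x a b)"
  by (simp add: zseg_def)

lemma theta_zc: "e \<le> length x \<Longrightarrow> card {k. k < e \<and> \<not> x ! k \<and> K k} = theta x K (zc x e)"
  unfolding theta_def zseg_def by (rule arg_cong[where f=card]) (auto simp: zc_less_iff)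

lemma theta_0 [simp]: "theta x K 0 = 0"
  by (simp add: theta_def zseg_def)

lemma thin_ones_at:
  "ones_at (thin x K) w = card {e. e < length x \<and> x ! e \<and> K e \<and> theta x K (zc x e) = w}"
  unfolding thin_ones_at_aux by (rule arg_cong[where f=card]) (auto simp: theta_zc)

text \<open>This separates two kinds of coins: those of the ones decide through \<open>alive\<close>
  which points survive, those of the zeros decide through \<open>theta\<close> where they land. The
  ends of the string go to the ends of the trace.\<close>

lemma thin_pts: "pts (thin x K) = theta x K ` {s \<in> pts x. alive x K s}"
proof -
  have tot: "zc (thin x K) (length (thin x K)) = theta x K (zc x (length x))"
    unfolding thin_total by (rule theta_zc) simp
  have "0 < ones_at (thin x K) w \<longleftrightarrow> (\<exists>e<length x. x ! e \<and> K e \<and> theta x K (zc x e) = w)" for w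
  proof -
    have "finite {e. e < length x \<and> x ! e \<and> K e \<and> theta x K (zc x e) = w}" by simp
    then show ?thesis unfolding thin_ones_at card_gt_0_iff by auto
  qed
  then have "w \<in> pts (thin x K) \<longleftrightarrow> w = 0 \<or> w = theta x K (zc x (length x)) \<or>
      (\<exists>e<length x. x ! e \<and> K e \<and> theta x K (zc x e) = w)" for w
    by (simp add: pts_iff tot)
  moreover have "{s \<in> pts x. alive x K s} = {0, zc x (length x)} \<union> {zc x e | e. e < length x \<and> x ! e \<and> K e}"
    by (auto simp: pts_def alive_def) metis
  moreover have "theta x K ` ({0, zc x (length x)} \<union> {zc x e | e. e < length x \<and> x ! e \<and> K e}) =
    {0, theta x K (zc x (length x))} \<union> {theta x K (zc x e) | e. e < length x \<and> x ! e \<and> K e}"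
    by (auto simp: image_Un)
  ultimately show ?thesis by (intro set_eqI) (simp only: Un_iff insert_iff empty_iff mem_Collect_eq, blast)
qed

text \<open>On the positions of zeros, \<open>zc\<close> is a bijection onto the numbers below the
  total number of zeros.\<close>

lemma card_zseg:
  assumes "a \<le> b" "b \<le> zc x (length x)"
  shows "card (zseg x a b) = b - a"
proof -
  let ?Z = "{k. k < length x \<and> \<not> x ! k}"
  have inj: "inj_on (zc x) ?Z"
    by (rule inj_onI) (metis (mono_tags, lifting) linorder_neqE_nat mem_Collect_eq nat_less_le zc_less)
  have "zc x ` ?Z = {..<zc x (length x)}"
  proof (rule card_subset_eq)
    show "zc x ` ?Z \<subseteq> {..<zc x (length x)}" using zc_less by auto
    show "card (zc x ` ?Z) = card {..<zc x (length x)}" using card_image[OF inj] by (simp add: zc_def)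
  qed simp
  then have "zc x ` zseg x a b = {a..<b}"
    using assms unfolding zseg_def by (auto simp: image_iff set_eq_iff) (metis lessThan_iff less_le_trans)
  moreover have "inj_on (zc x) (zseg x a b)"
    using inj by (rule inj_on_subset) (auto simp: zseg_def)
  ultimately show ?thesis by (metis card_image card_atLeastLessThan)
qed

lemma theta_diff:
  assumes "a \<le> b"
  shows "theta x K b = theta x K a + card {k \<in> zseg x a b. K k}"
proof -
  have "{k \<in> zseg x 0 b. K k} = {k \<in> zseg x 0 a. K k} \<union> {k \<in> zseg x a b. K k}"
    using assms by (auto simp: zseg_def)
  moreover have "{k \<in> zseg x 0 a. K k} \<inter> {k \<in> zseg x a b. K k} = {}" by (auto simp: zseg_def)
  ultimately show ?thesis unfolding theta_def by (simp add: card_Un_disjoint)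
qed

section \<open>Concentration of distances and survival of patterns\<close>

definition good :: "real \<Rightarrow> bool list \<Rightarrow> (nat \<Rightarrow> bool) \<Rightarrow> bool" where
  "good l x K \<longleftrightarrow> (\<forall>a\<le>zc x (length x). \<forall>b\<le>zc x (length x).
     \<bar>(real (theta x K a) - real (theta x K b)) - (real a - real b) / 2\<bar> \<le> l * sqrt \<bar>real a - real b\<bar>)"

text \<open>Hoeffding's inequality for each pair and a union bound. With \<open>l\<close> the
  logarithm of the length, the bound decays faster than any power of the length.\<close>

lemma prob_not_good:
  assumes "0 \<le> l"
  shows "measure_pmf.prob (coins (length x)) {K. \<not> good l x K}
    \<le> 2 * (real (length x) + 1)\<^sup>2 * exp (- 2 * l\<^sup>2)"
proof -
  let ?N = "zc x (length x)" and ?P = "measure_pmf.prob (coins (length x))"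
  \<comment> \<open>Restricting to \<open>a < b\<close> makes \<open>zseg x a b\<close> nonempty, as
    Hoeffding's inequality demands; the other order follows by symmetry.\<close>
  define bad where "bad = (\<lambda>(a, b). {K. a < b \<and> b \<le> ?N \<and>
    l * sqrt (real (card (zseg x a b))) \<le> \<bar>real (card {k \<in> zseg x a b. K k}) - real (card (zseg x a b)) / 2\<bar>})"
  have gd: "\<bar>(real (theta x K a) - real (theta x K b)) - (real a - real b) / 2\<bar> \<le> l * sqrt \<bar>real a - real b\<bar>"
    if "a < b" "b \<le> ?N" "K \<notin> bad (a, b)" for K a b
  proof -
    have *: "theta x K b = theta x K a + card {k \<in> zseg x a b. K k}" "card (zseg x a b) = b - a"
      using that theta_diff card_zseg by auto
    have e: "(real (theta x K a) - real (theta x K b)) - (real a - real b) / 2 =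
        - (real (card {k \<in> zseg x a b. K k}) - real (b - a) / 2)" "\<bar>real a - real b\<bar> = real (b - a)"
      using that by (simp_all add: *(1) of_nat_diff field_simps)
    show ?thesis using that unfolding bad_def e abs_minus_cancel by (simp add: *(2))
  qed
  have "{K. \<not> good l x K} \<subseteq> (\<Union>ab\<in>{..length x} \<times> {..length x}. bad ab)"
  proof
    fix K assume "K \<in> {K. \<not> good l x K}"
    then obtain a b where ab: "a \<le> ?N" "b \<le> ?N"
      "\<not> \<bar>(real (theta x K a) - real (theta x K b)) - (real a - real b) / 2\<bar> \<le> l * sqrt \<bar>real a - real b\<bar>"
      by (auto simp: good_def)
    have "a \<noteq> b" using ab(3) by auto
    then consider "a < b" | "b < a" by linarith
    then have "K \<in> bad (a, b) \<or> K \<in> bad (b, a)"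
    proof cases
      case 1
      then show ?thesis using gd[of a b K] ab by blast
    next
      case 2
      have sw: "\<bar>(real (theta x K b) - real (theta x K a)) - (real b - real a) / 2\<bar> =
        \<bar>(real (theta x K a) - real (theta x K b)) - (real a - real b) / 2\<bar>"
        "\<bar>real b - real a\<bar> = \<bar>real a - real b\<bar>" by (auto simp: abs_if field_simps)
      show ?thesis using gd[of b a K] ab 2 unfolding sw by blast
    qed
    moreover have "?N \<le> length x" by (rule zc_le)
    ultimately show "K \<in> (\<Union>ab\<in>{..length x} \<times> {..length x}. bad ab)" using ab by force
  qed
  then have "?P {K. \<not> good l x K} \<le> ?P (\<Union>ab\<in>{..length x} \<times> {..length x}. bad ab)"
    by (rule measure_pmf.finite_measure_mono) simp
  also have "\<dots> \<le> (\<Sum>ab\<in>{..length x} \<times> {..length x}. ?P (bad ab))"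
    by (rule measure_pmf.finite_measure_subadditive_finite) auto
  also have "\<dots> \<le> (\<Sum>ab\<in>{..length x} \<times> {..length x}. 2 * exp (- 2 * l\<^sup>2))"
  proof (rule sum_mono)
    fix ab :: "nat \<times> nat"
    obtain a b where ab: "ab = (a, b)" by force
    show "?P (bad ab) \<le> 2 * exp (- 2 * l\<^sup>2)"
    proof (cases "a < b \<and> b \<le> ?N")
      case True
      then have c: "card (zseg x a b) = b - a" using card_zseg by auto
      have "?P (bad ab) \<le> 2 * exp (- 2 * (l * sqrt (real (card (zseg x a b))))\<^sup>2 / real (card (zseg x a b)))"
      proof -
        have "zseg x a b \<noteq> {}" using True c by force
        moreover have "zseg x a b \<subseteq> {..<length x}" by (auto simp: zseg_def)
        ultimately show ?thesis
          unfolding ab bad_def using True coins_deviation[of "zseg x a b" "length x" "l * sqrt (real (card (zseg x a b)))"] assms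
          by simp
      qed
      also have "\<dots> = 2 * exp (- 2 * l\<^sup>2)" using True c by (simp add: power_mult_distrib)
      finally show ?thesis .
    next
      case False
      then have "bad ab = {}" by (auto simp: ab bad_def)
      then show ?thesis by simp
    qed
  qed
  also have "\<dots> = 2 * (real (length x) + 1)\<^sup>2 * exp (- 2 * l\<^sup>2)"
    by (simp add: power2_eq_square algebra_simps)
  finally show ?thesis .
qed

lemma deletion_channel_half: "deletion_channel (1/2) x = map_pmf (thin x) (coins (length x))"
  by (simp add: deletion_channel_def coins_def)

lemma prob_deletion_channel:
  "measure_pmf.prob (deletion_channel (1/2) x) A = measure_pmf.prob (coins (length x)) {K. thin x K \<in> A}"
  by (simp add: deletion_channel_half vimage_def)

text \<open>For each point of \<open>S\<close> other than the two ends, choose one of its ones; it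
  suffices that all chosen ones survive.\<close>

lemma prob_alive:
  assumes "S \<subseteq> pts x"
  shows "(1/2) ^ card S \<le> measure_pmf.prob (coins (length x)) {K. \<forall>s\<in>S. alive x K s}"
proof -
  define T where "T = {s\<in>S. s \<noteq> 0 \<and> s \<noteq> zc x (length x)}"
  have "\<forall>s\<in>T. \<exists>e. e < length x \<and> x ! e \<and> zc x e = s"
    using assms unfolding T_def pts_def by auto
  then obtain f where f: "\<And>s. s \<in> T \<Longrightarrow> f s < length x \<and> x ! f s \<and> zc x (f s) = s" by metis
  have fin: "finite S" using finite_subset[OF assms pts_finite] .
  have "card (f ` T) \<le> card S"
  proof -
    have "T \<subseteq> S" by (auto simp: T_def)
    then show ?thesis
      using card_image_le[of T f] card_mono[OF fin, of T] finite_subset[OF _ fin] by (meson order_trans)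
  qed
  then have "(1/2::real) ^ card S \<le> (1/2) ^ card (f ` T)" by (intro power_decreasing) auto
  also have "\<dots> = measure_pmf.prob (coins (length x)) {K. \<forall>e\<in>f ` T. K e}"
    by (rule prob_all_heads[symmetric]) (use f in auto)
  also have "\<dots> \<le> measure_pmf.prob (coins (length x)) {K. \<forall>s\<in>S. alive x K s}"
  proof (rule measure_pmf.finite_measure_mono)
    show "{K. \<forall>e\<in>f ` T. K e} \<subseteq> {K. \<forall>s\<in>S. alive x K s}"
    proof safe
      fix K s assume "\<forall>e\<in>f ` T. K e" "s \<in> S"
      then show "alive x K s" using f[of s] unfolding alive_def T_def by auto
    qed
  qed simp
  finally show ?thesis .
qed

section \<open>Patterns\<close>

definition win :: "real \<Rightarrow> (nat \<Rightarrow> nat) \<Rightarrow> nat \<Rightarrow> nat \<Rightarrow> bool" where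
  "win c f s s' \<longleftrightarrow> \<bar>(real (f s) - real (f s')) - (real s - real s') / 2\<bar> \<le> c * sqrt \<bar>real s - real s'\<bar>"

lemma win_cong: "f s = f' s \<Longrightarrow> f s' = f' s' \<Longrightarrow> win c f s s' = win c f' s s'"
  by (simp add: win_def)

lemma win_shift:
  assumes "real (f s) - real (f s') = real (f' s) - real (f' s')"
  shows "win c f s s' = win c f' s s'"
  by (simp add: win_def assms)

lemma win_good:
  assumes "good l x K" "s \<in> pts x" "s' \<in> pts x"
  shows "win l (theta x K) s s'"
  using assms pts_le by (simp add: good_def win_def)

lemma halves:
  fixes u v w P Q :: real
  assumes "\<bar>u - v / 2\<bar> \<le> P" "\<bar>u - w / 2\<bar> \<le> Q"
  shows "\<bar>v - w\<bar> \<le> 2 * Q + 2 * P"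
  using assms by (simp add: abs_le_iff field_simps)

text \<open>The distance in the trace is close to half of that of \<open>s\<close>,
  \<open>s'\<close> by the window, and to half of that of \<open>g s\<close>, \<open>g s'\<close> by
  \<open>good\<close>. Comparison gives the error \<open>2 * (k * l * a) + 2 * (l * b)\<close>, and
  \<open>b \<le> 2 * a\<close> turns it into the constant \<open>2 * k + 4\<close>.\<close>

lemma win_lift:
  assumes good: "good l x K" and g: "g s \<in> pts x" "g s' \<in> pts x"
    and f: "f s = theta x K (g s)" "f s' = theta x K (g s')"
    and win: "win (k * l) f s s'" and k: "0 \<le> k" "0 < l" "((2 * k + 2) * l)\<^sup>2 \<le> \<bar>real s - real s'\<bar>"
  shows "\<bar>(real (g s) - real (g s')) - (real s - real s')\<bar> \<le> (2 * k + 4) * l * sqrt \<bar>real s - real s'\<bar>"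
proof -
  define a b where "a = sqrt \<bar>real s - real s'\<bar>" and "b = sqrt \<bar>real (g s) - real (g s')\<bar>"
  have a2: "a * a = \<bar>real s - real s'\<bar>" and b2: "b * b = \<bar>real (g s) - real (g s')\<bar>"
    by (simp_all add: a_def b_def)
  have nn: "0 \<le> a" "0 \<le> b" by (simp_all add: a_def b_def)
  have ka: "(2 * k + 2) * l \<le> a" unfolding a_def using k by (intro real_le_rsqrt) auto
  have 1: "\<bar>(real (theta x K (g s)) - real (theta x K (g s'))) - (real (g s) - real (g s')) / 2\<bar> \<le> l * b"
    using win_good[OF good g] by (simp add: win_def b_def)
  have 2: "\<bar>(real (theta x K (g s)) - real (theta x K (g s'))) - (real s - real s') / 2\<bar> \<le> k * l * a"
    using win by (simp add: win_def a_def f)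
  have 3: "\<bar>(real (g s) - real (g s')) - (real s - real s')\<bar> \<le> 2 * (k * l * a) + 2 * (l * b)"
    by (rule halves[OF 1 2])
  \<comment> \<open>Otherwise \<open>b * b - a * a\<close> is at most
    \<open>((2 * k + 2) * l) * b\<close>, hence at most \<open>a * b\<close>, which is impossible
    for \<open>2 * a < b\<close>.\<close>
  have "b \<le> 2 * a"
  proof (rule ccontr)
    assume "\<not> b \<le> 2 * a"
    then have ab: "2 * a < b" by simp
    have "b * b - a * a \<le> 2 * (k * l * a) + 2 * (l * b)" using 3 a2 b2 by linarith
    also have "\<dots> \<le> 2 * (k * l * b) + 2 * (l * b)"
      using ab nn k by (intro add_mono mult_left_mono) auto
    also have "\<dots> = ((2 * k + 2) * l) * b" by (simp add: algebra_simps)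
    also have "\<dots> \<le> a * b" using ka nn by (intro mult_right_mono) auto
    finally have "b * b \<le> a * (a + b)" by (simp add: algebra_simps)
    also have "\<dots> \<le> a * (b + b)" using ab nn by (intro mult_left_mono) auto
    also have "\<dots> = (2 * a) * b" by simp
    also have "\<dots> < b * b" using ab nn by (intro mult_strict_right_mono) auto
    finally show False by simp
  qed
  then have "l * b \<le> l * (2 * a)" using k by (intro mult_left_mono) auto
  then show ?thesis using 3 unfolding a_def[symmetric] by (simp add: algebra_simps)
qed

text \<open>A property of the point set \<open>P\<close> alone: for \<open>P = pts t\<close>,
  existence of a fit is an event of the trace \<open>t\<close>.\<close>

definition fit :: "real \<Rightarrow> nat set \<Rightarrow> nat set \<Rightarrow> (nat \<Rightarrow> nat) \<Rightarrow> bool" where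
  "fit l S P f \<longleftrightarrow> f ` S \<subseteq> P \<and> (\<forall>s\<in>S. \<forall>s'\<in>S. win l f s s')"

text \<open>Windows across the gap from \<open>p\<close> to \<open>q\<close> are not tested (apart from the harmless one for
  \<open>p, q\<close> itself), so that the match carries no information about the coins inside the gap.\<close>

definition gap_fit :: "real \<Rightarrow> nat \<Rightarrow> nat \<Rightarrow> nat set \<Rightarrow> nat set \<Rightarrow> (nat \<Rightarrow> nat) \<Rightarrow> bool" where
  "gap_fit l p q S P f \<longleftrightarrow> f ` S \<subseteq> P \<and> win (5 * l) f q p \<and>
     (\<forall>s\<in>S. \<forall>s'\<in>S. s \<le> p \<and> s' \<le> p \<or> q \<le> s \<and> q \<le> s' \<longrightarrow> win l f s s')"

lemma lift_points:
  assumes "f ` S \<subseteq> pts (thin x K)"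
  obtains g where "\<And>s. s \<in> S \<Longrightarrow> g s \<in> pts x \<and> alive x K (g s) \<and> f s = theta x K (g s)"
proof -
  have "\<forall>s\<in>S. \<exists>u. u \<in> pts x \<and> alive x K u \<and> f s = theta x K u"
    using assms unfolding thin_pts by blast
  then obtain g where "\<forall>s\<in>S. g s \<in> pts x \<and> alive x K (g s) \<and> f s = theta x K (g s)"
    by (rule bchoice[THEN exE])
  then show ?thesis using that by blast
qed

text \<open>The constant 6 is that of \<open>win_lift\<close> for \<open>k = 1\<close>.\<close>

lemma fit_lift:
  assumes good: "good l x K" and f: "fit l S (pts (thin x K)) f"
    and sep: "separated L S" and L: "0 < l" "16 * l\<^sup>2 \<le> L"
  obtains g where "\<And>s. s \<in> S \<Longrightarrow> g s \<in> pts x \<and> alive x K (g s) \<and> f s = theta x K (g s)"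
    "emb (6 * l) S (pts x) g"
proof -
  obtain g where g: "\<And>s. s \<in> S \<Longrightarrow> g s \<in> pts x \<and> alive x K (g s) \<and> f s = theta x K (g s)"
    using lift_points[of f S x K] f unfolding fit_def by blast
  have "\<bar>(real (g s) - real (g s')) - (real s - real s')\<bar> \<le> (6 * l) * sqrt \<bar>real s - real s'\<bar>"
    if s: "s \<in> S" "s' \<in> S" for s s'
  proof (cases "s = s'")
    case False
    have "((2 * 1 + 2) * l)\<^sup>2 \<le> \<bar>real s - real s'\<bar>"
      using separatedD[OF sep s False] L by (simp add: power_mult_distrib)
    moreover have "win (1 * l) f s s'" using f s by (simp add: fit_def)
    ultimately show ?thesis using win_lift[OF good, of g s s' f 1] g s L by simp
  qed simp
  then have "emb (6 * l) S (pts x) g" using g by (auto simp: emb_def)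
  with g show ?thesis using that by blast
qed

text \<open>Pairs on one side of the gap get the constant 6, the gap itself gets 14 from
  \<open>win_lift\<close> with \<open>k = 5\<close>, and pairs across are split at \<open>p\<close>
  and \<open>q\<close>, whence 26 = 6 + 14 + 6.\<close>

lemma gap_fit_lift:
  assumes good: "good l x K" and f: "gap_fit l p q S (pts (thin x K)) f"
    and sep: "separated L S" and L: "0 < l" "144 * l\<^sup>2 \<le> L"
    and pq: "p \<in> S" "q \<in> S" "p < q" "\<And>s. s \<in> S \<Longrightarrow> s \<le> p \<or> q \<le> s"
  obtains g where "\<And>s. s \<in> S \<Longrightarrow> g s \<in> pts x \<and> alive x K (g s) \<and> f s = theta x K (g s)"
    "emb (26 * l) S (pts x) g"
proof -
  obtain g where g: "\<And>s. s \<in> S \<Longrightarrow> g s \<in> pts x \<and> alive x K (g s) \<and> f s = theta x K (g s)"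
    using lift_points[of f S x K] f unfolding gap_fit_def by blast
  have close: "\<bar>(real (g s) - real (g s')) - (real s - real s')\<bar> \<le> (6 * l) * sqrt \<bar>real s - real s'\<bar>"
    if s: "s \<in> S" "s' \<in> S" "s \<le> p \<and> s' \<le> p \<or> q \<le> s \<and> q \<le> s'" for s s'
  proof (cases "s = s'")
    case False
    have "((2 * 1 + 2) * l)\<^sup>2 \<le> \<bar>real s - real s'\<bar>"
      using separatedD[OF sep s(1,2) False] L by (simp add: power_mult_distrib)
    moreover have "win (1 * l) f s s'" using f s by (auto simp: gap_fit_def)
    ultimately show ?thesis using win_lift[OF good, of g s s' f 1] g s L by simp
  qed simp
  have gap: "\<bar>(real (g q) - real (g p)) - (real q - real p)\<bar> \<le> (14 * l) * sqrt \<bar>real q - real p\<bar>"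
  proof -
    have "((2 * 5 + 2) * l)\<^sup>2 \<le> \<bar>real q - real p\<bar>"
      using separatedD[OF sep pq(2,1)] pq(3) L by (simp add: power_mult_distrib)
    moreover have "win (5 * l) f q p" using f by (auto simp: gap_fit_def)
    ultimately show ?thesis using win_lift[OF good, of g q p f 5] g pq L by simp
  qed
  have cross: "\<bar>(real (g s') - real (g s)) - (real s' - real s)\<bar> \<le> (26 * l) * sqrt \<bar>real s' - real s\<bar>"
    if s: "s \<in> S" "s' \<in> S" "s \<le> p" "q \<le> s'" for s s'
  proof -
    let ?r = "sqrt \<bar>real s' - real s\<bar>"
    have "l * sqrt \<bar>real p - real s\<bar> \<le> l * ?r" "l * sqrt \<bar>real q - real p\<bar> \<le> l * ?r" "l * sqrt \<bar>real s' - real q\<bar> \<le> l * ?r"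
      using s pq L by (auto intro!: mult_left_mono)
    moreover have "\<bar>(real (g p) - real (g s)) - (real p - real s)\<bar> \<le> (6 * l) * sqrt \<bar>real p - real s\<bar>"
      using close[of p s] s pq by auto
    moreover have "\<bar>(real (g s') - real (g q)) - (real s' - real q)\<bar> \<le> (6 * l) * sqrt \<bar>real s' - real q\<bar>"
      using close[of s' q] s pq by auto
    ultimately have "\<bar>(real (g p) - real (g s)) - (real p - real s)\<bar> \<le> 6 * (l * ?r)"
      "\<bar>(real (g s') - real (g q)) - (real s' - real q)\<bar> \<le> 6 * (l * ?r)"
      "\<bar>(real (g q) - real (g p)) - (real q - real p)\<bar> \<le> 14 * (l * ?r)"
      using gap by (simp_all only: mult.assoc)
    then have "\<bar>(real (g s') - real (g s)) - (real s' - real s)\<bar> \<le> 26 * (l * ?r)"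
      unfolding abs_le_iff by linarith
    then show ?thesis by (simp only: mult.assoc)
  qed
  have "\<bar>(real (g s) - real (g s')) - (real s - real s')\<bar> \<le> (26 * l) * sqrt \<bar>real s - real s'\<bar>"
    if s: "s \<in> S" "s' \<in> S" for s s'
  proof -
    consider "s \<le> p \<and> s' \<le> p \<or> q \<le> s \<and> q \<le> s'" | "s \<le> p" "q \<le> s'" | "s' \<le> p" "q \<le> s"
      using pq(4) s by blast
    then show ?thesis
    proof cases
      case 1
      have "(6 * l) * sqrt \<bar>real s - real s'\<bar> \<le> (26 * l) * sqrt \<bar>real s - real s'\<bar>"
        using L by (intro mult_right_mono) auto
      then show ?thesis using close[OF s 1] by linarith
    next
      case 2
      have "\<bar>(real (g s) - real (g s')) - (real s - real s')\<bar> = \<bar>(real (g s') - real (g s)) - (real s' - real s)\<bar>"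
        by linarith
      then show ?thesis using cross[OF s 2] by (simp only: abs_minus_commute[of "real s" "real s'"])
    next
      case 3
      then show ?thesis using cross[OF s(2,1)] by blast
    qed
  qed
  then have "emb (26 * l) S (pts x) g" using g by (auto simp: emb_def)
  with g show ?thesis using that by blast
qed

text \<open>The distinguishing event is that the trace admits a fit of \<open>S\<close>. For
  \<open>x\<close> it occurs when \<open>S\<close> survives and \<open>good\<close> holds. For
  \<open>y\<close> a fit under \<open>good\<close> lifts to an embedding, so without embeddings the
  event is too rare for the channels to be \<eta>-close.\<close>

lemma embedding_exists:
  assumes len: "length x = n" "length y = n"
    and close: "\<And>A. \<bar>measure_pmf.prob (deletion_channel (1/2) x) A - measure_pmf.prob (deletion_channel (1/2) y) A\<bar> \<le> \<eta>"
    and S: "S \<subseteq> pts x" "separated L S" "0 < l" "16 * l\<^sup>2 \<le> L"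
    and small: "\<eta> + 2 * (2 * (real n + 1)\<^sup>2 * exp (- 2 * l\<^sup>2)) < (1/2) ^ card S"
  shows "\<exists>g. emb (6 * l) S (pts y) g"
proof (rule ccontr)
  assume no: "\<not> ?thesis"
  let ?d = "2 * (real n + 1)\<^sup>2 * exp (- 2 * l\<^sup>2)" and ?P = "measure_pmf.prob (coins n)"
  define A where "A = {t. \<exists>f. fit l S (pts t) f}"
  have "thin y K \<notin> A" if good: "good l y K" for K
  proof
    assume "thin y K \<in> A"
    then obtain f where "fit l S (pts (thin y K)) f" by (auto simp: A_def)
    from fit_lift[OF good this S(2,3,4)] no show False by blast
  qed
  then have "{K. thin y K \<in> A} \<subseteq> {K. \<not> good l y K}" by auto
  then have "?P {K. thin y K \<in> A} \<le> ?P {K. \<not> good l y K}"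
    by (rule measure_pmf.finite_measure_mono) simp
  then have y: "?P {K. thin y K \<in> A} \<le> ?d"
    using prob_not_good[of l y] S len by simp
  have "thin x K \<in> A" if "good l x K" "\<forall>s\<in>S. alive x K s" for K
  proof -
    have "fit l S (pts (thin x K)) (theta x K)"
      unfolding fit_def thin_pts using that(2) S(1) win_good[OF that(1)] by blast
    then show ?thesis by (auto simp: A_def)
  qed
  then have "{K. \<forall>s\<in>S. alive x K s} \<subseteq> {K. thin x K \<in> A} \<union> {K. \<not> good l x K}" by auto
  then have "?P {K. \<forall>s\<in>S. alive x K s} \<le> ?P ({K. thin x K \<in> A} \<union> {K. \<not> good l x K})"
    by (rule measure_pmf.finite_measure_mono) simp
  also have "\<dots> \<le> ?P {K. thin x K \<in> A} + ?P {K. \<not> good l x K}"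
    by (rule measure_Un_le) auto
  also have "\<dots> \<le> ?P {K. thin x K \<in> A} + ?d"
    using prob_not_good[of l x] S len by simp
  finally have "(1/2) ^ card S \<le> ?P {K. thin x K \<in> A} + ?d"
    using prob_alive[OF S(1)] len by simp
  moreover have "?P {K. thin x K \<in> A} \<le> ?P {K. thin y K \<in> A} + \<eta>"
    using close[of A] len by (simp add: prob_deletion_channel)
  ultimately show False using y small by linarith
qed

section \<open>Tests based on the number of survivors\<close>

abbreviation bad_prob :: "nat \<Rightarrow> real \<Rightarrow> real" where
  "bad_prob n l \<equiv> 2 * (real n + 1)\<^sup>2 * exp (- 2 * l\<^sup>2)"

text \<open>If \<open>P\<close> is the probability of an event independent of the fair coins in \<open>W\<close>, then the number of
  heads in \<open>W\<close>, restricted to that event, has first and second moments \<open>a P / 2\<close> and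
  \<open>(a\<^sup>2 + a) P / 4\<close> with \<open>a = card W\<close>; two equations eliminate the unknown \<open>P\<close>.\<close>

lemma solve_moments:
  fixes P P' e :: real and a a' n :: nat
  assumes 1: "\<bar>a * P - a' * P'\<bar> \<le> 2 * (n * e)"
    and 2: "\<bar>(real a ^ 2 + a) * P - (real a' ^ 2 + a') * P'\<bar> \<le> 4 * ((real n)\<^sup>2 * e)"
    and a: "1 \<le> a" "a \<le> n" "a' \<le> n" and e: "0 \<le> e" "8 * (real n)\<^sup>2 * e < P"
  shows "a = a'"
proof (rule ccontr)
  assume "a \<noteq> a'"
  then have d: "1 \<le> \<bar>real a - real a'\<bar>" by linarith
  have P: "0 < P" using e by (smt (verit) mult_nonneg_nonneg zero_le_power2)
  have "\<bar>(real a' + 1) * (a * P - a' * P')\<bar> \<le> (2 * real n) * (2 * (n * e))"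
    unfolding abs_mult using 1 a by (intro mult_mono) auto
  also have "\<dots> = 4 * ((real n)\<^sup>2 * e)" by (simp add: power2_eq_square)
  finally have 3: "\<bar>(real a' + 1) * (a * P - a' * P')\<bar> \<le> 4 * ((real n)\<^sup>2 * e)" .
  \<comment> \<open>Subtracting \<open>a' + 1\<close> times the first relation from the second
    eliminates \<open>P'\<close>.\<close>
  have "(real a - real a') * (a * P) =
    ((real a ^ 2 + a) * P - (real a' ^ 2 + a') * P') - (real a' + 1) * (a * P - a' * P')"
    by (simp add: power2_eq_square algebra_simps)
  then have "\<bar>(real a - real a') * (a * P)\<bar> \<le> 8 * ((real n)\<^sup>2 * e)" using 2 3 by linarith
  moreover have "1 * (1 * P) \<le> \<bar>real a - real a'\<bar> * (a * P)"
    using d a P by (intro mult_mono) auto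
  then have "P \<le> \<bar>(real a - real a') * (a * P)\<bar>" using P a by (simp add: abs_mult)
  ultimately show False using e by linarith
qed

text \<open>Up to a rare event, \<Phi> computes from the trace alone the number of heads in
  \<open>W\<close> on \<open>B\<close>, although \<open>W\<close> and \<open>B\<close> are not
  visible there.\<close>

lemma test_moments:
  fixes \<Phi> :: "bool list \<Rightarrow> nat"
  assumes len: "length x = n" and l: "0 \<le> l" and bound: "\<And>t. \<Phi> t \<le> n"
    and W: "W \<subseteq> {..<n}" and indep: "\<And>K e b. e \<in> W \<Longrightarrow> B (K(e := b)) = B K"
    and \<Phi>: "\<And>K. good l x K \<Longrightarrow> \<Phi> (thin x K) = (if B K then card {e\<in>W. K e} else 0)"
  shows "\<bar>measure_pmf.expectation (deletion_channel (1/2) x) (\<lambda>t. real (\<Phi> t)) -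
      real (card W) / 2 * measure_pmf.prob (coins n) {K. B K}\<bar> \<le> real n * bad_prob n l"
    and "\<bar>measure_pmf.expectation (deletion_channel (1/2) x) (\<lambda>t. real ((\<Phi> t)\<^sup>2)) -
      ((real (card W))\<^sup>2 + real (card W)) / 4 * measure_pmf.prob (coins n) {K. B K}\<bar> \<le> (real n)\<^sup>2 * bad_prob n l"
proof -
  have c: "card {e\<in>W. K e} \<le> n" for K :: "nat \<Rightarrow> bool"
    using card_mono[of "{..<n}" "{e\<in>W. K e}"] W by auto
  have bad: "measure_pmf.prob (coins n) {K. \<not> good l x K} \<le> bad_prob n l"
    using prob_not_good[OF l, of x] len by simp
  have "\<bar>measure_pmf.expectation (coins n) (\<lambda>K. real (\<Phi> (thin x K))) -
      measure_pmf.expectation (coins n) (\<lambda>K. if B K then real (card {e\<in>W. K e}) else 0)\<bar>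
     \<le> real n * measure_pmf.prob (coins n) {K. \<not> good l x K}"
    by (rule expectation_cong_event) (use \<Phi> c bound in auto)
  also have "\<dots> \<le> real n * bad_prob n l" using bad by (intro mult_left_mono) auto
  finally show "\<bar>measure_pmf.expectation (deletion_channel (1/2) x) (\<lambda>t. real (\<Phi> t)) -
      real (card W) / 2 * measure_pmf.prob (coins n) {K. B K}\<bar> \<le> real n * bad_prob n l"
    by (simp add: expectation_card[OF W indep] deletion_channel_half len)
  have c2: "(real (card {e\<in>W. K e}))\<^sup>2 \<le> (real n)\<^sup>2" "(real (\<Phi> t))\<^sup>2 \<le> (real n)\<^sup>2" for K t
    using c bound by (auto intro!: power_mono)
  have "\<bar>measure_pmf.expectation (coins n) (\<lambda>K. (real (\<Phi> (thin x K)))\<^sup>2) -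
      measure_pmf.expectation (coins n) (\<lambda>K. if B K then (real (card {e\<in>W. K e}))\<^sup>2 else 0)\<bar>
     \<le> (real n)\<^sup>2 * measure_pmf.prob (coins n) {K. \<not> good l x K}"
    by (rule expectation_cong_event) (use \<Phi> c2 in auto)
  also have "\<dots> \<le> (real n)\<^sup>2 * bad_prob n l" using bad by (intro mult_left_mono) auto
  finally show "\<bar>measure_pmf.expectation (deletion_channel (1/2) x) (\<lambda>t. real ((\<Phi> t)\<^sup>2)) -
      ((real (card W))\<^sup>2 + real (card W)) / 4 * measure_pmf.prob (coins n) {K. B K}\<bar> \<le> (real n)\<^sup>2 * bad_prob n l"
    by (simp add: expectation_card_square[OF W indep] deletion_channel_half len)
qed

text \<open>The same statistic \<Phi> is read through \<open>W\<close>, \<open>B\<close> for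
  \<open>x\<close> and through \<open>W'\<close>, \<open>B'\<close> for \<open>y\<close>. Closeness
  of the channels makes both moments nearly agree, and \<open>solve_moments\<close>
  concludes.\<close>

lemma test_card_eq:
  fixes \<Phi> :: "bool list \<Rightarrow> nat"
  assumes len: "length x = n" "length y = n" and l: "0 \<le> l" and bound: "\<And>t. \<Phi> t \<le> n"
    and close: "\<And>A. \<bar>measure_pmf.prob (deletion_channel (1/2) x) A - measure_pmf.prob (deletion_channel (1/2) y) A\<bar> \<le> \<eta>"
    and W: "W \<subseteq> {..<n}" and indep: "\<And>K e b. e \<in> W \<Longrightarrow> B (K(e := b)) = B K"
    and \<Phi>: "\<And>K. good l x K \<Longrightarrow> \<Phi> (thin x K) = (if B K then card {e\<in>W. K e} else 0)"
    and W': "W' \<subseteq> {..<n}" and indep': "\<And>K e b. e \<in> W' \<Longrightarrow> B' (K(e := b)) = B' K"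
    and \<Phi>': "\<And>K. good l y K \<Longrightarrow> \<Phi> (thin y K) = (if B' K then card {e\<in>W'. K e} else 0)"
    and pos: "1 \<le> card W" and large: "8 * (real n)\<^sup>2 * (\<eta> + 2 * bad_prob n l) < measure_pmf.prob (coins n) {K. B K}"
  shows "card W = card W'"
proof -
  let ?P = "measure_pmf.prob (coins n) {K. B K}" and ?P' = "measure_pmf.prob (coins n) {K. B' K}"
  let ?e = "\<eta> + 2 * bad_prob n l"
  note mx = test_moments[OF len(1) l bound W indep \<Phi>]
  note my = test_moments[OF len(2) l bound W' indep' \<Phi>']
  have d1: "\<bar>measure_pmf.expectation (deletion_channel (1/2) x) (\<lambda>t. real (\<Phi> t)) -
     measure_pmf.expectation (deletion_channel (1/2) y) (\<lambda>t. real (\<Phi> t))\<bar> \<le> real n * \<eta>"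
    by (rule expectation_close[OF close bound])
  have "\<bar>measure_pmf.expectation (deletion_channel (1/2) x) (\<lambda>t. real ((\<Phi> t)\<^sup>2)) -
     measure_pmf.expectation (deletion_channel (1/2) y) (\<lambda>t. real ((\<Phi> t)\<^sup>2))\<bar> \<le> real (n\<^sup>2) * \<eta>"
    by (rule expectation_close[OF close]) (use bound in \<open>auto intro: power_mono\<close>)
  then have d2: "\<bar>measure_pmf.expectation (deletion_channel (1/2) x) (\<lambda>t. real ((\<Phi> t)\<^sup>2)) -
     measure_pmf.expectation (deletion_channel (1/2) y) (\<lambda>t. real ((\<Phi> t)\<^sup>2))\<bar> \<le> (real n)\<^sup>2 * \<eta>" by simp
  have "\<bar>real (card W) / 2 * ?P - real (card W') / 2 * ?P'\<bar> \<le> real n * \<eta> + 2 * (real n * bad_prob n l)"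
    using mx(1) my(1) d1 unfolding abs_le_iff by linarith
  then have 1: "\<bar>real (card W) * ?P - real (card W') * ?P'\<bar> \<le> 2 * (real n * ?e)"
    by (simp add: abs_le_iff algebra_simps)
  have "\<bar>((real (card W))\<^sup>2 + real (card W)) / 4 * ?P - ((real (card W'))\<^sup>2 + real (card W')) / 4 * ?P'\<bar>
    \<le> (real n)\<^sup>2 * \<eta> + 2 * ((real n)\<^sup>2 * bad_prob n l)"
    using mx(2) my(2) d2 unfolding abs_le_iff by linarith
  then have 2: "\<bar>((real (card W))\<^sup>2 + real (card W)) * ?P - ((real (card W'))\<^sup>2 + real (card W')) * ?P'\<bar>
    \<le> 4 * ((real n)\<^sup>2 * ?e)"
  proof -
    have q: "\<bar>u * p - u' * p'\<bar> \<le> 4 * r" if "\<bar>u / 4 * p - u' / 4 * p'\<bar> \<le> r" for u u' p p' r :: real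
      using that by (simp add: abs_le_iff field_simps)
    show ?thesis using q[OF \<open>\<bar>_ / 4 * _ - _\<bar> \<le> _\<close>] by (simp add: algebra_simps)
  qed
  have "card W \<le> n" "card W' \<le> n" using W W' card_mono[of "{..<n}"] by force+
  moreover have "0 \<le> ?e" using close[of "{}"] by simp
  ultimately show ?thesis by (intro solve_moments[OF 1 2 pos]) (use large in auto)
qed

section \<open>A string is determined by its blocks of ones and its number of zeros\<close>

lemma zc_Cons: "zc (a # x) (Suc e) = zc x e + (if a then 0 else 1)"
proof -
  have "{k. k < Suc e \<and> \<not> (a # x) ! k} = Suc ` {k. k < e \<and> \<not> x ! k} \<union> (if a then {} else {0})"
    by (auto simp: image_iff less_Suc_eq_0_disj)
  then show ?thesis by (auto simp: zc_def card_Un_disjoint card_image)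
qed

lemma ones_at_Cons:
  "ones_at (a # x) s = (if a then ones_at x s + (if s = 0 then 1 else 0) else if s = 0 then 0 else ones_at x (s - 1))"
proof -
  have "{e. e < length (a # x) \<and> (a # x) ! e \<and> zc (a # x) e = s} =
    Suc ` {e. e < length x \<and> x ! e \<and> zc x e + (if a then 0 else 1) = s} \<union> (if a \<and> s = 0 then {0} else {})"
    by (auto simp: image_iff less_Suc_eq_0_disj zc_Cons)
  then have *: "ones_at (a # x) s = card {e. e < length x \<and> x ! e \<and> zc x e + (if a then 0 else 1) = s} +
      (if a \<and> s = 0 then 1 else 0)"
    by (auto simp: ones_at_def card_Un_disjoint card_image)
  show ?thesis
    unfolding * by (cases a; cases s) (auto simp: ones_at_def)
qed

text \<open>A nonempty string starts with a one exactly if its multiplicity at 0 is positive, so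
  symbols can be stripped one by one. The total number of zeros detects zeros at the end.\<close>

lemma ones_at_inject:
  assumes "\<And>s. ones_at x s = ones_at y s" "zc x (length x) = zc y (length y)"
  shows "x = y"
  using assms
proof (induction x arbitrary: y)
  case Nil
  have "ones_at y 0 = 0" "zc y (length y) = 0" using Nil(1)[of 0] Nil(2) by (simp_all add: ones_at_def)
  then show ?case by (cases y) (auto simp: ones_at_Cons zc_Cons split: if_splits)
next
  case (Cons a x)
  show ?case
  proof (cases y)
    case Nil
    have "ones_at (a # x) 0 = 0" "zc (a # x) (Suc (length x)) = 0"
      using Cons.prems(1)[of 0] Cons.prems(2) Nil by (simp_all add: ones_at_def)
    then show ?thesis by (auto simp: ones_at_Cons zc_Cons split: if_splits)
  next
    case y: (Cons b z)
    have "a = b"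
      using Cons.prems(1)[of 0] unfolding y ones_at_Cons by (auto split: if_splits)
    have "ones_at x s = ones_at z s" for s
      using Cons.prems(1)[of s] Cons.prems(1)[of "Suc s"] unfolding y ones_at_Cons \<open>a = b\<close>
      by (auto split: if_splits)
    moreover have "zc x (length x) = zc z (length z)"
      using Cons.prems(2) unfolding y \<open>a = b\<close> by (auto simp: zc_Cons)
    ultimately show ?thesis using Cons.IH[of z] \<open>a = b\<close> y by simp
  qed
qed

section \<open>Indistinguishable strings are equal\<close>

text \<open>The factor 57600 = 36 * 40 * 40 is what \<open>rigid_set\<close> asks for at noise
  \<open>40 * l\<close>. The size \<open>8 * h + 6\<close> covers all patterns in use, and
  \<open>small\<close> makes the survival probability of such a pattern exceed all error
  terms.\<close>

locale indistinguishable =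
  fixes n h :: nat and l L \<eta> :: real and x y :: "bool list"
  assumes len: "length x = n" "length y = n"
    and close: "\<And>A. \<bar>measure_pmf.prob (deletion_channel (1/2) x) A - measure_pmf.prob (deletion_channel (1/2) y) A\<bar> \<le> \<eta>"
    and sep: "separated L (pts x)" "separated L (pts y)"
    and l_pos: "0 < l" and L_ge_1: "1 \<le> L"
    and card_le: "57600 * l\<^sup>2 * real (card (pts x)) \<le> L" "57600 * l\<^sup>2 * real (card (pts y)) \<le> L"
    and n_pos: "1 \<le> n" and h: "3 * n \<le> 2 ^ h"
    and small: "8 * (real n)\<^sup>2 * (\<eta> + 2 * bad_prob n l) + bad_prob n l < (1/2) ^ (8 * h + 6)"
begin

lemma swap: "indistinguishable n h l L \<eta> y x"
  using len close sep l_pos L_ge_1 card_le n_pos h small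
  by (intro indistinguishable.intro) (auto simp: abs_minus_commute)

lemma L_ge: "57600 * l\<^sup>2 \<le> L"
proof -
  have "pts x \<noteq> {}" by (auto simp: pts_def)
  then have "1 \<le> card (pts x)" by (simp add: Suc_le_eq card_gt_0_iff)
  then have "57600 * l\<^sup>2 * 1 \<le> 57600 * l\<^sup>2 * real (card (pts x))" by (intro mult_left_mono) auto
  then show ?thesis using card_le by linarith
qed

lemma L_gt:
  assumes "c \<le> 57599"
  shows "c * l\<^sup>2 < L"
proof -
  have "c * l\<^sup>2 \<le> 57599 * l\<^sup>2" using assms by (intro mult_right_mono) auto
  moreover have "0 < l\<^sup>2" using l_pos by simp
  ultimately show ?thesis using L_ge by linarith
qed

lemma eta_nonneg: "0 \<le> \<eta>"
  using close[of "{}"] by simp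

lemma embeds:
  assumes "S \<subseteq> pts x" "card S \<le> 8 * h + 6"
  shows "\<exists>g. emb (6 * l) S (pts y) g"
proof (rule embedding_exists[OF len close])
  have "\<eta> + 2 * bad_prob n l \<le> (8 * (real n)\<^sup>2) * (\<eta> + 2 * bad_prob n l)"
  proof -
    have "1 \<le> (real n)\<^sup>2" using n_pos by (intro one_le_power) simp
    then have "1 * (\<eta> + 2 * bad_prob n l) \<le> (8 * (real n)\<^sup>2) * (\<eta> + 2 * bad_prob n l)"
      using eta_nonneg by (intro mult_right_mono) auto
    then show ?thesis by simp
  qed
  also have "\<dots> < (1/2) ^ (8 * h + 6)" using small by (smt (verit) exp_gt_zero mult_nonneg_nonneg zero_le_power2)
  also have "\<dots> \<le> (1/2) ^ card S" using assms by (intro power_decreasing) auto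
  finally show "\<eta> + 2 * bad_prob n l < (1/2) ^ card S" .
qed (use assms sep l_pos L_gt[of 16] in \<open>auto intro: separated_subset\<close>)

text \<open>The pattern \<open>S\<close> pins \<open>p\<close> within \<open>x\<close>. The noise
  level 40 leaves room for a map to \<open>pts y\<close> followed by a map back, at cost 26 + 2 * 6
  = 38 (\<open>emb_return\<close>).\<close>

definition anchored :: "nat set \<Rightarrow> nat \<Rightarrow> bool" where
  "anchored S p \<longleftrightarrow> S \<subseteq> pts x \<and> p \<in> S \<and> card S \<le> 2 * h + 1 \<and> (\<forall>g. emb (40 * l) S (pts x) g \<longrightarrow> g p = p)"

lemma anchored_exists:
  assumes "p \<in> pts x"
  shows "\<exists>S. anchored S p"
proof -
  have "36 * (40 * l)\<^sup>2 * real (card (pts x)) \<le> L" using card_le by (simp add: power_mult_distrib)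
  from rigid_set[OF pts_finite pts_le_length assms sep(1) _ this L_ge_1, of h] h l_pos len
  show ?thesis unfolding anchored_def by simp
qed

lemma emb_return:
  assumes S: "anchored S p" and g: "emb (26 * l) S (pts y) g" and T: "g ` S \<subseteq> T" and h: "emb (6 * l) T (pts x) f"
  shows "f (g p) = p"
proof -
  have "emb (26 * l + 2 * (6 * l)) S (pts x) (f \<circ> g)"
  proof (rule emb_comp[OF g h T])
    show "separated L S" using S sep separated_subset unfolding anchored_def by blast
    show "(26 * l)\<^sup>2 \<le> 9 * L" using L_gt[of 676] L_ge_1 by (simp add: power_mult_distrib)
  qed (use l_pos in auto)
  then have "emb (40 * l) S (pts x) (f \<circ> g)" by (rule emb_mono) (use l_pos in auto)
  then have "(f \<circ> g) p = p" using S unfolding anchored_def by blast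
  then show ?thesis by simp
qed

lemma returns:
  assumes "T \<subseteq> pts y" "card T \<le> 8 * h + 6"
  obtains f where "emb (6 * l) T (pts x) f" "\<And>u v. u \<in> T \<Longrightarrow> v \<in> T \<Longrightarrow> u < v \<Longrightarrow> f u < f v"
proof -
  from indistinguishable.embeds[OF swap assms] obtain f where f: "emb (6 * l) T (pts x) f" ..
  moreover have "f u < f v" if "u \<in> T" "v \<in> T" "u < v" for u v
  proof (rule emb_less[OF f _ _ _ that])
    show "separated L T" using assms sep separated_subset by blast
    show "(6 * l)\<^sup>2 < L" using L_gt[of 36] by (simp add: power_mult_distrib)
  qed (use l_pos in auto)
  ultimately show ?thesis using that by blast
qed

lemma card_union_image:
  assumes "anchored S p"
  shows "card (g1 ` S \<union> g2 ` S) \<le> 4 * h + 2"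
proof -
  have fin: "finite S" using assms finite_subset[OF _ pts_finite] unfolding anchored_def by blast
  have "card (g1 ` S \<union> g2 ` S) \<le> card (g1 ` S) + card (g2 ` S)" by (rule card_Un_le)
  also have "\<dots> \<le> card S + card S" by (intro add_mono card_image_le fin)
  finally show "card (g1 ` S \<union> g2 ` S) \<le> 4 * h + 2" using assms unfolding anchored_def by linarith
qed

text \<open>Both images are pulled back by one common embedding into \<open>pts x\<close>, where \<open>p\<close> is rigid.\<close>

lemma image_unique:
  assumes S: "anchored S p" and g: "emb (26 * l) S (pts y) g1" "emb (26 * l) S (pts y) g2"
  shows "g1 p = g2 p"
proof -
  let ?T = "g1 ` S \<union> g2 ` S"
  have T: "?T \<subseteq> pts y" "card ?T \<le> 8 * h + 6"
    using g card_union_image[OF S, of g1 g2] by (auto simp: emb_def)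
  then obtain f where f: "emb (6 * l) ?T (pts x) f" "\<And>u v. u \<in> ?T \<Longrightarrow> v \<in> ?T \<Longrightarrow> u < v \<Longrightarrow> f u < f v"
    by (rule returns) blast
  have "f (g1 p) = p" "f (g2 p) = p" using emb_return[OF S _ _ f(1)] g by auto
  moreover have "g1 p \<in> ?T" "g2 p \<in> ?T" using S by (auto simp: anchored_def)
  ultimately show ?thesis using f(2)[of "g1 p" "g2 p"] f(2)[of "g2 p" "g1 p"] by (metis linorder_neqE_nat less_irrefl)
qed

text \<open>The point 0 lies in both point sets. If \<open>g 0\<close> were positive, the monotone
  return map would send 0 strictly below \<open>f (g 0) = 0\<close>.\<close>

lemma image_zero:
  assumes S: "anchored S 0" and g: "emb (26 * l) S (pts y) g"
  shows "g 0 = 0"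
proof (rule ccontr)
  assume "g 0 \<noteq> 0"
  let ?T = "insert 0 (g ` S \<union> g ` S)"
  have "?T \<subseteq> pts y" using g by (auto simp: emb_def pts_def)
  moreover have "card ?T \<le> 8 * h + 6"
    using card_insert_le_m1[of "8 * h + 6" "g ` S \<union> g ` S" 0] card_union_image[OF S, of g g] by simp
  ultimately obtain f where f: "emb (6 * l) ?T (pts x) f" "\<And>u v. u \<in> ?T \<Longrightarrow> v \<in> ?T \<Longrightarrow> u < v \<Longrightarrow> f u < f v"
    by (rule returns) blast
  have "f (g 0) = 0" by (rule emb_return[OF S g _ f(1)]) auto
  moreover have "f 0 < f (g 0)" using f(2)[of 0 "g 0"] S \<open>g 0 \<noteq> 0\<close> by (auto simp: anchored_def)
  ultimately show False by simp
qed

text \<open>Supplies the lower bound on the probability of the event that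
  \<open>test_card_eq\<close> requires.\<close>

lemma prob_all_alive_good:
  assumes S: "S \<subseteq> pts x" "card S \<le> 8 * h + 6"
    and B: "\<And>K. good l x K \<Longrightarrow> \<forall>s\<in>S. alive x K s \<Longrightarrow> B K"
  shows "8 * (real n)\<^sup>2 * (\<eta> + 2 * bad_prob n l) < measure_pmf.prob (coins n) {K. B K}"
proof -
  let ?P = "measure_pmf.prob (coins n)"
  have "{K. \<forall>s\<in>S. alive x K s} \<subseteq> {K. B K} \<union> {K. \<not> good l x K}" using B by auto
  then have "?P {K. \<forall>s\<in>S. alive x K s} \<le> ?P ({K. B K} \<union> {K. \<not> good l x K})"
    by (rule measure_pmf.finite_measure_mono) simp
  also have "\<dots> \<le> ?P {K. B K} + ?P {K. \<not> good l x K}" by (rule measure_Un_le) auto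
  also have "\<dots> \<le> ?P {K. B K} + bad_prob n l" using prob_not_good[of l x] l_pos len by simp
  finally have "(1/2) ^ card S \<le> ?P {K. B K} + bad_prob n l"
    using prob_alive[OF S(1)] len by simp
  moreover have "(1/2::real) ^ (8 * h + 6) \<le> (1/2) ^ card S" using S by (intro power_decreasing) auto
  ultimately show ?thesis using small by linarith
qed

end

section \<open>The length of a block of ones, read off from traces\<close>

text \<open>Survival at \<open>u\<close> itself is left out and the other pattern points avoid
  \<open>u\<close>, so the event is independent of the coins of the ones at
  \<open>u\<close>.\<close>

definition mass_event :: "real \<Rightarrow> nat set \<Rightarrow> nat \<Rightarrow> bool list \<Rightarrow> nat \<Rightarrow> (nat \<Rightarrow> bool) \<Rightarrow> bool" where
  "mass_event l S p z u K \<longleftrightarrow> (\<exists>g. g p = u \<and> g ` S \<subseteq> pts z \<and> (\<forall>s\<in>S - {p}. g s \<noteq> u \<and> alive z K (g s)) \<and>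
     (\<forall>s\<in>S. \<forall>s'\<in>S. win l (theta z K \<circ> g) s s'))"

text \<open>The choice of \<open>f\<close> is immaterial: outside an event of negligible probability all fits agree at \<open>p\<close>.\<close>

definition mass_stat :: "nat \<Rightarrow> real \<Rightarrow> nat set \<Rightarrow> nat \<Rightarrow> bool list \<Rightarrow> nat" where
  "mass_stat n l S p t = (if \<exists>f. fit l S (pts t) f then min n (ones_at t ((SOME f. fit l S (pts t) f) p)) else 0)"

lemma theta_flip_one: "z ! e \<Longrightarrow> theta z (K(e := b)) s = theta z K s"
  unfolding theta_def zseg_def by (rule arg_cong[where f=card]) auto

lemma alive_flip_other: "\<not> z ! e \<or> zc z e \<noteq> s \<Longrightarrow> alive z (K(e := b)) s = alive z K s"
  unfolding alive_def by auto

lemma mass_event_flip: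
  assumes "z ! e" "zc z e = u"
  shows "mass_event l S p z u (K(e := b)) = mass_event l S p z u K"
proof -
  have "theta z (K(e := b)) = theta z K" using theta_flip_one[OF assms(1)] by auto
  moreover have "(g s \<noteq> u \<and> alive z (K(e := b)) (g s)) = (g s \<noteq> u \<and> alive z K (g s))" for g :: "nat \<Rightarrow> nat" and s
    using alive_flip_other[of z e "g s" K b] assms by (cases "g s = u") auto
  ultimately show ?thesis unfolding mass_event_def by simp
qed

text \<open>Distances of at least \<open>L\<close> are too large for the noise to close, so the ones
  of a trace at one point stem from a single block of \<open>z\<close>.\<close>

lemma theta_inj:
  assumes "good l z K" "separated L (pts z)" "0 < l" "4 * l\<^sup>2 < L" "a \<in> pts z" "b \<in> pts z" "theta z K a = theta z K b"
  shows "a = b"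
proof (rule ccontr)
  assume "a \<noteq> b"
  then have d: "L \<le> \<bar>real a - real b\<bar>" using separatedD[OF assms(2,5,6)] by blast
  have "win l (theta z K) a b" using win_good[OF assms(1,5,6)] .
  then have "\<bar>real a - real b\<bar> \<le> (2 * l) * sqrt \<bar>real a - real b\<bar>" using assms(7) by (simp add: win_def)
  moreover have "2 * l < sqrt \<bar>real a - real b\<bar>"
    using d assms by (intro real_less_rsqrt) (auto simp: power_mult_distrib)
  then have "(2 * l) * sqrt \<bar>real a - real b\<bar> < sqrt \<bar>real a - real b\<bar> * sqrt \<bar>real a - real b\<bar>"
    using assms(3) by (intro mult_strict_right_mono) auto
  ultimately show False by simp
qed

text \<open>Every fit lifts to an embedding, which takes \<open>p\<close> to \<open>u\<close> by
  \<open>uniq\<close>; the ones of the trace at \<open>f p\<close> are then exactly the survivors of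
  the block at \<open>u\<close>.\<close>

lemma mass_stat_eq:
  assumes len: "length z = n" and good: "good l z K" and sep: "separated L (pts z)" "separated L S"
    and l: "0 < l" "36 * l\<^sup>2 < L" and p: "p \<in> S" and u: "u \<in> pts z"
    and uniq: "\<And>g. emb (6 * l) S (pts z) g \<Longrightarrow> g p = u"
  shows "mass_stat n l S p (thin z K) = (if mass_event l S p z u K then card {e \<in> {e. e < n \<and> z ! e \<and> zc z e = u}. K e} else 0)"
proof -
  let ?W = "{e \<in> {e. e < n \<and> z ! e \<and> zc z e = u}. K e}"
  have l': "16 * l\<^sup>2 \<le> L" "4 * l\<^sup>2 < L" using l by (smt (verit) zero_le_power2)+
  have c: "card ?W \<le> n" using card_mono[of "{..<n}" ?W] by auto
  have ones: "ones_at (thin z K) (theta z K u) = card ?W"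
    unfolding thin_ones_at
  proof (rule arg_cong[where f=card], safe)
    fix e assume e: "e < length z" "z ! e" "theta z K (zc z e) = theta z K u"
    then have "zc z e \<in> pts z" by (auto simp: pts_def)
    then show "zc z e = u" using theta_inj[OF good sep(1) l(1) l'(2) _ u e(3)] by blast
  qed (use len in auto)
  have fitD: "mass_event l S p z u K \<and> f p = theta z K u" if f: "fit l S (pts (thin z K)) f" for f
  proof -
    obtain g where g: "\<And>s. s \<in> S \<Longrightarrow> g s \<in> pts z \<and> alive z K (g s) \<and> f s = theta z K (g s)"
      "emb (6 * l) S (pts z) g" using fit_lift[OF good f sep(2) l(1) l'(1)] by blast
    have gp: "g p = u" by (rule uniq[OF g(2)])
    have "g s \<noteq> u" if "s \<in> S - {p}" for s
    proof -
      have "(6 * l)\<^sup>2 < L" "0 \<le> 6 * l" using l by (auto simp: power_mult_distrib)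
      then have "s < p \<Longrightarrow> g s < g p" "p < s \<Longrightarrow> g p < g s"
        using emb_less[OF g(2) sep(2)] that p by auto
      then show ?thesis using that gp by (metis Diff_iff insertI1 less_irrefl linorder_neqE_nat)
    qed
    moreover have "win l (theta z K \<circ> g) s s'" if "s \<in> S" "s' \<in> S" for s s'
    proof -
      have "win l f s s'" using f that by (simp add: fit_def)
      then show ?thesis using win_cong[of f s "theta z K \<circ> g" s' l] g(1) that by simp
    qed
    moreover have "g ` S \<subseteq> pts z" using g(1) by blast
    ultimately have "mass_event l S p z u K" unfolding mass_event_def using g(1) gp by blast
    then show ?thesis using g(1)[OF p] gp by simp
  qed
  show ?thesis
  proof (cases "\<exists>f. fit l S (pts (thin z K)) f")
    case True
    then have "fit l S (pts (thin z K)) (SOME f. fit l S (pts (thin z K)) f)" by (rule someI_ex)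
    from fitD[OF this] show ?thesis using True c by (simp add: mass_stat_def ones)
  next
    case False
    \<comment> \<open>The event is silent about survival at \<open>u\<close>. If it holds although
      there is no fit, then no one at \<open>u\<close> survives, so the count is 0 like the
      statistic.\<close>
    have "card ?W = 0" if B: "mass_event l S p z u K"
    proof (rule ccontr)
      assume "card ?W \<noteq> 0"
      then have "?W \<noteq> {}" by auto
      then have "alive z K u" using len by (auto simp: alive_def)
      with B obtain g where g: "g p = u" "g ` S \<subseteq> pts z" "\<forall>s\<in>S. alive z K (g s)"
        "\<forall>s\<in>S. \<forall>s'\<in>S. win l (theta z K \<circ> g) s s'" unfolding mass_event_def by blast
      then have "fit l S (pts (thin z K)) (theta z K \<circ> g)"
        unfolding fit_def thin_pts by auto
      then show False using False by blast
    qed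
    then show ?thesis using False by (simp add: mass_stat_def)
  qed
qed

context indistinguishable begin

text \<open>Compares the block of ones at \<open>p\<close> in \<open>x\<close> with the one at
  \<open>g p\<close> in \<open>y\<close>. The uniqueness required by \<open>mass_stat_eq\<close>
  comes from anchoring in \<open>x\<close> and from \<open>image_unique\<close> in
  \<open>y\<close>.\<close>

lemma mass_eq:
  assumes S: "anchored S p" and g: "emb (6 * l) S (pts y) g" and pos: "1 \<le> ones_at x p"
  shows "ones_at y (g p) = ones_at x p"
proof -
  let ?W = "\<lambda>z u. {e. e < n \<and> z ! e \<and> zc z e = u}"
  have Sx: "S \<subseteq> pts x" and p: "p \<in> S" and cS: "card S \<le> 2 * h + 1" using S by (auto simp: anchored_def)
  have sepS: "separated L S" using separated_subset[OF sep(1) Sx] .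
  have l36: "36 * l\<^sup>2 < L" using L_gt[of 36] by simp
  have ux: "f p = p" if "emb (6 * l) S (pts x) f" for f
    using emb_mono[OF that order_refl, of "40 * l"] S l_pos by (auto simp: anchored_def)
  have uy: "f p = g p" if "emb (6 * l) S (pts y) f" for f
    using image_unique[OF S] emb_mono[OF that order_refl, of "26 * l"] emb_mono[OF g order_refl, of "26 * l"] l_pos by auto
  have "card (?W x p) = card (?W y (g p))"
  proof (rule test_card_eq[where \<Phi>="mass_stat n l S p" and B="mass_event l S p x p" and B'="mass_event l S p y (g p)", OF len _ _ close])
    show "mass_stat n l S p (thin x K) = (if mass_event l S p x p K then card {e \<in> ?W x p. K e} else 0)" if "good l x K" for K
    proof (rule mass_stat_eq[OF len(1) that sep(1) sepS l_pos l36 p])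
      show "p \<in> pts x" using Sx p by blast
    qed (rule ux)
    show "mass_stat n l S p (thin y K) = (if mass_event l S p y (g p) K then card {e \<in> ?W y (g p). K e} else 0)" if "good l y K" for K
      by (rule mass_stat_eq[OF len(2) that sep(2) sepS l_pos l36 p emb_mem[OF g p]]) (rule uy)
    show "1 \<le> card (?W x p)" using pos len by (simp add: ones_at_def)
    show "8 * (real n)\<^sup>2 * (\<eta> + 2 * bad_prob n l) < measure_pmf.prob (coins n) {K. mass_event l S p x p K}"
    proof (rule prob_all_alive_good[OF Sx])
      fix K assume K: "good l x K" "\<forall>s\<in>S. alive x K s"
      have "win l (theta x K \<circ> (\<lambda>s. s)) s s'" if "s \<in> S" "s' \<in> S" for s s'
        using win_good[OF K(1), of s s'] Sx that by (auto simp: o_def)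
      with K(2) Sx show "mass_event l S p x p K" unfolding mass_event_def
        by (intro exI[of _ "\<lambda>s. s"]) auto
    qed (use cS in auto)
    show "mass_stat n l S p t \<le> n" for t by (simp add: mass_stat_def)
  qed (use l_pos mass_event_flip in auto)
  then show ?thesis using len by (simp add: ones_at_def)
qed

end

section \<open>The length of a gap between adjacent points, read off from traces\<close>

text \<open>The order conditions keep the images of both sides outside the segment from
  \<open>u\<close> to \<open>v\<close>, and only points of the same side are compared; hence
  \<open>gap_event_flip\<close>.\<close>

definition gap_event :: "real \<Rightarrow> nat \<Rightarrow> nat \<Rightarrow> nat set \<Rightarrow> bool list \<Rightarrow> nat \<Rightarrow> nat \<Rightarrow> (nat \<Rightarrow> bool) \<Rightarrow> bool" where
  "gap_event l p q S z u v K \<longleftrightarrow> (\<exists>g. g p = u \<and> g q = v \<and> (\<forall>s\<in>S. g s \<in> pts z \<and> alive z K (g s)) \<and>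
     (\<forall>s\<in>S. (s \<le> p \<longrightarrow> g s \<le> u) \<and> (q \<le> s \<longrightarrow> v \<le> g s)) \<and>
     (\<forall>s\<in>S. \<forall>s'\<in>S. s \<le> p \<and> s' \<le> p \<or> q \<le> s \<and> q \<le> s' \<longrightarrow> win l (theta z K \<circ> g) s s'))"

definition gap_stat :: "nat \<Rightarrow> real \<Rightarrow> nat \<Rightarrow> nat \<Rightarrow> nat set \<Rightarrow> bool list \<Rightarrow> nat" where
  "gap_stat n l p q S t = (if \<exists>f. gap_fit l p q S (pts t) f
     then min n ((SOME f. gap_fit l p q S (pts t) f) q - (SOME f. gap_fit l p q S (pts t) f) p) else 0)"

lemma theta_flip_below:
  assumes "k \<in> zseg z u v" "s \<le> u"
  shows "theta z (K(k := b)) s = theta z K s"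
  unfolding theta_def by (rule arg_cong[where f=card]) (use assms in \<open>auto simp: zseg_def\<close>)

text \<open>A coin below \<open>v\<close> shifts both values by the same amount.\<close>

lemma theta_flip_above:
  assumes k: "k \<in> zseg z u v" and s: "v \<le> s" "v \<le> s'"
  shows "real (theta z (K(k := b)) s) - real (theta z (K(k := b)) s') = real (theta z K s) - real (theta z K s')"
proof -
  have "{j \<in> zseg z v t. (K(k := b)) j} = {j \<in> zseg z v t. K j}" for t
    using k by (auto simp: zseg_def)
  then show ?thesis
    using theta_diff[OF s(1), of z K] theta_diff[OF s(2), of z K]
      theta_diff[OF s(1), of z "K(k := b)"] theta_diff[OF s(2), of z "K(k := b)"] by simp
qed

lemma gap_event_flip:
  assumes k: "k \<in> zseg z u v" and S: "p \<in> S" "q \<in> S"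
  shows "gap_event l p q S z u v (K(k := b)) = gap_event l p q S z u v K"
proof -
  have al: "alive z (K(k := b)) s = alive z K s" for s
    using k by (intro alive_flip_other) (auto simp: zseg_def)
  have w: "win l (theta z (K(k := b)) \<circ> g) s s' = win l (theta z K \<circ> g) s s'"
    if "\<forall>s\<in>S. (s \<le> p \<longrightarrow> g s \<le> u) \<and> (q \<le> s \<longrightarrow> v \<le> g s)" "s \<in> S" "s' \<in> S"
      "s \<le> p \<and> s' \<le> p \<or> q \<le> s \<and> q \<le> s'" for g s s'
  proof (rule win_shift)
    from that consider "g s \<le> u" "g s' \<le> u" | "v \<le> g s" "v \<le> g s'" by blast
    then show "real ((theta z (K(k := b)) \<circ> g) s) - real ((theta z (K(k := b)) \<circ> g) s') =
        real ((theta z K \<circ> g) s) - real ((theta z K \<circ> g) s')"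
      by cases (use theta_flip_below[OF k] theta_flip_above[OF k] in auto)
  qed
  show ?thesis
    unfolding gap_event_def al by (intro ex_cong1 conj_cong refl ball_cong imp_cong) (use w in blast)
qed

text \<open>A fit lifts to an embedding and yields the event by \<open>uniq\<close>. Conversely, a
  realization of the event yields a fit, since under \<open>good\<close> the window across the gap
  holds automatically.\<close>

lemma gap_stat_eq:
  assumes len: "length z = n" and good: "good l z K" and sep: "separated L (pts z)" "separated L S"
    and l: "0 < l" "676 * l\<^sup>2 < L" and pq: "p \<in> S" "q \<in> S" "p < q" "\<And>s. s \<in> S \<Longrightarrow> s \<le> p \<or> q \<le> s"
    and uv: "u \<in> pts z" "v \<in> pts z" "u < v"
    and near: "\<bar>(real v - real u) - (real q - real p)\<bar> \<le> 6 * l * sqrt \<bar>real q - real p\<bar>"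
    and uniq: "\<And>g. emb (26 * l) S (pts z) g \<Longrightarrow> g p = u \<and> g q = v"
  shows "gap_stat n l p q S (thin z K) = (if gap_event l p q S z u v K then card {k \<in> zseg z u v. K k} else 0)"
proof -
  have l': "144 * l\<^sup>2 \<le> L" "36 * l\<^sup>2 \<le> 9 * L" using l by (smt (verit) zero_le_power2)+
  have c: "card {k \<in> zseg z u v. K k} \<le> n"
    using card_mono[of "{..<n}" "{k \<in> zseg z u v. K k}"] len by (auto simp: zseg_def)
  have diff: "theta z K v - theta z K u = card {k \<in> zseg z u v. K k}"
    using theta_diff[of u v z K] uv by simp
  have fitD: "gap_event l p q S z u v K \<and> f p = theta z K u \<and> f q = theta z K v"
    if f: "gap_fit l p q S (pts (thin z K)) f" for f
  proof -
    obtain g where g: "\<And>s. s \<in> S \<Longrightarrow> g s \<in> pts z \<and> alive z K (g s) \<and> f s = theta z K (g s)"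
      "emb (26 * l) S (pts z) g" using gap_fit_lift[OF good f sep(2) l(1) l'(1) pq] by blast
    have gp: "g p = u" "g q = v" using uniq[OF g(2)] by auto
    have "(26 * l)\<^sup>2 < L" "0 \<le> 26 * l" using l by (auto simp: power_mult_distrib)
    then have mono: "s < s' \<Longrightarrow> g s < g s'" if "s \<in> S" "s' \<in> S" for s s'
      using emb_less[OF g(2) sep(2)] that by auto
    have "(s \<le> p \<longrightarrow> g s \<le> u) \<and> (q \<le> s \<longrightarrow> v \<le> g s)" if "s \<in> S" for s
      using mono[OF that pq(1)] mono[OF pq(2) that] gp by (auto simp: le_less)
    moreover have "win l (theta z K \<circ> g) s s'" if "s \<in> S" "s' \<in> S" "s \<le> p \<and> s' \<le> p \<or> q \<le> s \<and> q \<le> s'" for s s'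
    proof -
      have "win l f s s'" using f that unfolding gap_fit_def by blast
      then show ?thesis using win_cong[of f s "theta z K \<circ> g" s' l] g(1) that by simp
    qed
    ultimately have "gap_event l p q S z u v K" unfolding gap_event_def using g(1) gp by blast
    then show ?thesis using g(1)[OF pq(1)] g(1)[OF pq(2)] gp by simp
  qed
  show ?thesis
  proof (cases "\<exists>f. gap_fit l p q S (pts (thin z K)) f")
    case True
    then have "gap_fit l p q S (pts (thin z K)) (SOME f. gap_fit l p q S (pts (thin z K)) f)" by (rule someI_ex)
    from fitD[OF this] show ?thesis using True c by (simp add: gap_stat_def diff)
  next
    case False
    have "\<not> gap_event l p q S z u v K"
    proof
      assume "gap_event l p q S z u v K"
      then obtain g where g: "g p = u" "g q = v" "\<And>s. s \<in> S \<Longrightarrow> g s \<in> pts z \<and> alive z K (g s)"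
        "\<And>s s'. s \<in> S \<Longrightarrow> s' \<in> S \<Longrightarrow> s \<le> p \<and> s' \<le> p \<or> q \<le> s \<and> q \<le> s' \<Longrightarrow> win l (theta z K \<circ> g) s s'"
        unfolding gap_event_def by blast
      \<comment> \<open>By \<open>good\<close> the distance in the trace is within
        \<open>2 * l * sqrt ?D\<close> of half of \<open>v - u\<close>, which by \<open>near\<close>
        is within \<open>3 * l * sqrt ?D\<close> of half of \<open>q - p\<close>. This is the origin
        of the factor 5 in \<open>gap_fit\<close>.\<close>
      have "win (5 * l) (theta z K \<circ> g) q p"
      proof -
        let ?D = "\<bar>real q - real p\<bar>" and ?E = "\<bar>real v - real u\<bar>"
        have "L \<le> ?D" using separatedD[OF sep(2) pq(2,1)] pq(3) by simp
        then have "6 * l * sqrt ?D \<le> 3 * ?D"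
          using l'(2) by (intro mult_sqrt_le) (auto simp: power_mult_distrib)
        then have "?E \<le> 4 * ?D" using near by (smt (verit))
        then have "sqrt ?E \<le> 2 * sqrt ?D" using real_sqrt_le_mono[of ?E "4 * ?D"] by (simp add: real_sqrt_mult)
        then have "l * sqrt ?E \<le> l * (2 * sqrt ?D)" using l by (intro mult_left_mono) auto
        moreover have "\<bar>(real (theta z K v) - real (theta z K u)) - (real v - real u) / 2\<bar> \<le> l * sqrt ?E"
          using win_good[OF good uv(2,1)] by (simp add: win_def)
        ultimately have "\<bar>(real (theta z K v) - real (theta z K u)) - (real q - real p) / 2\<bar> \<le> 5 * (l * sqrt ?D)"
          using near by (simp add: abs_le_iff field_simps)
        then show ?thesis using g(1,2) by (simp add: win_def)
      qed
      moreover have "(theta z K \<circ> g) ` S \<subseteq> pts (thin z K)" using g(3) by (auto simp: thin_pts)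
      ultimately have "gap_fit l p q S (pts (thin z K)) (theta z K \<circ> g)"
        unfolding gap_fit_def using g(4) by blast
      then show False using False by blast
    qed
    then show ?thesis using False by (simp add: gap_stat_def)
  qed
qed

context indistinguishable begin

text \<open>The points \<open>p\<close> and \<open>q\<close> are adjacent, so no pattern point lies
  between them. Counting the surviving zeros of the gap upgrades the approximate distance to an
  exact one.\<close>

lemma gap_eq:
  assumes Sp: "anchored Sp p" and Sq: "anchored Sq q" and pq: "p < q" "\<And>s. s \<in> pts x \<Longrightarrow> s \<le> p \<or> q \<le> s"
    and g: "emb (6 * l) (Sp \<union> Sq) (pts y) g"
  shows "real (g q) - real (g p) = real q - real p"
proof -
  let ?S = "Sp \<union> Sq"
  have Sx: "?S \<subseteq> pts x" and p: "p \<in> ?S" "q \<in> ?S" using Sp Sq by (auto simp: anchored_def)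
  have cS: "card ?S \<le> 8 * h + 6" using card_Un_le[of Sp Sq] Sp Sq unfolding anchored_def by linarith
  have sepS: "separated L ?S" using separated_subset[OF sep(1) Sx] .
  have l676: "676 * l\<^sup>2 < L" using L_gt[of 676] by simp
  have dich: "s \<le> p \<or> q \<le> s" if "s \<in> ?S" for s using pq(2) Sx that by blast
  have ux: "f p = p \<and> f q = q" if "emb (26 * l) ?S (pts x) f" for f
    using emb_mono[OF that, of Sp "40 * l"] emb_mono[OF that, of Sq "40 * l"] Sp Sq l_pos by (auto simp: anchored_def)
  have uy: "f p = g p \<and> f q = g q" if "emb (26 * l) ?S (pts y) f" for f
    using image_unique[OF Sp, of f g] image_unique[OF Sq, of f g] emb_mono[OF that, of Sp "26 * l"] emb_mono[OF that, of Sq "26 * l"]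
      emb_mono[OF g, of Sp "26 * l"] emb_mono[OF g, of Sq "26 * l"] l_pos by auto
  have lt: "g p < g q"
  proof (rule emb_less[OF g sepS _ _ p pq(1)])
    show "(6 * l)\<^sup>2 < L" using L_gt[of 36] by (simp add: power_mult_distrib)
  qed (use l_pos in simp)
  have px: "p \<in> pts x" "q \<in> pts x" using p Sx by auto
  have py: "g p \<in> pts y" "g q \<in> pts y" using emb_mem[OF g] p by auto
  have "card (zseg x p q) = card (zseg y (g p) (g q))"
  proof (rule test_card_eq[where \<Phi>="gap_stat n l p q ?S" and B="gap_event l p q ?S x p q" and B'="gap_event l p q ?S y (g p) (g q)", OF len _ _ close])
    show "gap_stat n l p q ?S (thin x K) = (if gap_event l p q ?S x p q K then card {e \<in> zseg x p q. K e} else 0)" if "good l x K" for K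
      by (rule gap_stat_eq[OF len(1) that sep(1) sepS l_pos l676 p pq(1) dich px pq(1)]) (use ux l_pos in auto)
    show "gap_stat n l p q ?S (thin y K) = (if gap_event l p q ?S y (g p) (g q) K then card {e \<in> zseg y (g p) (g q). K e} else 0)" if "good l y K" for K
    proof (rule gap_stat_eq[OF len(2) that sep(2) sepS l_pos l676 p pq(1) dich py lt])
      show "\<bar>(real (g q) - real (g p)) - (real q - real p)\<bar> \<le> 6 * l * sqrt \<bar>real q - real p\<bar>"
        by (rule embD[OF g p(2,1)])
    qed (use uy in auto)
    show "1 \<le> card (zseg x p q)" using card_zseg[of p q x] pts_le[OF px(2)] pq(1) by simp
    show "8 * (real n)\<^sup>2 * (\<eta> + 2 * bad_prob n l) < measure_pmf.prob (coins n) {K. gap_event l p q ?S x p q K}"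
    proof (rule prob_all_alive_good[OF Sx cS])
      fix K assume K: "good l x K" "\<forall>s\<in>?S. alive x K s"
      have "win l (theta x K \<circ> (\<lambda>s. s)) s s'" if "s \<in> ?S" "s' \<in> ?S" for s s'
        using win_good[OF K(1), of s s'] Sx that by (auto simp: o_def)
      with K(2) Sx show "gap_event l p q ?S x p q K" unfolding gap_event_def
        by (intro exI[of _ "\<lambda>s. s"]) auto
    qed
    show "gap_stat n l p q ?S t \<le> n" for t by (simp add: gap_stat_def)
    show "gap_event l p q ?S x p q (K(e := b)) = gap_event l p q ?S x p q K" if "e \<in> zseg x p q" for K e b
      using gap_event_flip[OF that p] .
    show "gap_event l p q ?S y (g p) (g q) (K(e := b)) = gap_event l p q ?S y (g p) (g q) K" if "e \<in> zseg y (g p) (g q)" for K e b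
      using gap_event_flip[OF that p] .
  qed (use l_pos len in \<open>auto simp: zseg_def\<close>)
  then have "q - p = g q - g p"
    using card_zseg[of p q x] card_zseg[of "g p" "g q" y] pts_le[OF px(2)] pts_le[OF py(2)] pq(1) lt by simp
  then show "real (g q) - real (g p) = real q - real p"
    using pq(1) lt by (metis less_imp_le_nat of_nat_diff)
qed

section \<open>Transport of all points from one string to the other\<close>

text \<open>Induction from left to right: \<open>image_zero\<close> starts it, and the exact gap to
  the preceding point \<open>p'\<close> carries it on.\<close>

lemma image_fixed:
  assumes "anchored S p" "emb (26 * l) S (pts y) g"
  shows "g p = p"
  using assms
proof (induction p arbitrary: S g rule: less_induct)
  case (less p)
  show ?case
  proof (cases "p = 0")
    case True
    then show ?thesis using image_zero[of S g] less.prems by simp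
  next
    case False
    let ?B = "{s \<in> pts x. s < p}"
    define p' where "p' = Max ?B"
    have "0 \<in> ?B" using False by (auto simp: pts_def)
    then have "p' \<in> ?B" unfolding p'_def by (intro Max_in) auto
    then have p': "p' \<in> pts x" "p' < p" by auto
    have adj: "s \<le> p' \<or> p \<le> s" if "s \<in> pts x" for s
      using Max_ge[of ?B s] that unfolding p'_def by force
    obtain S' where S': "anchored S' p'" using anchored_exists[OF p'(1)] by blast
    \<comment> \<open>A single map must place both patterns for \<open>gap_eq\<close> to compare
      \<open>p'\<close> and \<open>p\<close>; \<open>image_unique\<close> then passes from
      \<open>f\<close> to the given \<open>g\<close>.\<close>
    have "S' \<union> S \<subseteq> pts x" "card (S' \<union> S) \<le> 8 * h + 6"
      using S' less.prems(1) card_Un_le[of S' S] unfolding anchored_def by auto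
    then obtain f where f: "emb (6 * l) (S' \<union> S) (pts y) f" using embeds by blast
    have "f p' = p'" by (rule less.IH[OF p'(2) S']) (rule emb_mono[OF f], use l_pos in auto)
    moreover have "g p = f p"
      by (rule image_unique[OF less.prems]) (rule emb_mono[OF f], use l_pos in auto)
    ultimately show ?thesis using gap_eq[OF S' less.prems(1) p'(2) adj f] by simp
  qed
qed

lemma pts_subset: "pts x \<subseteq> pts y"
  and ones_at_le: "1 \<le> ones_at x p \<Longrightarrow> ones_at y p = ones_at x p"
proof -
  have *: "\<exists>S g. anchored S p \<and> emb (6 * l) S (pts y) g \<and> g p = p" if "p \<in> pts x" for p
  proof -
    from anchored_exists[OF that] obtain S where S: "anchored S p" ..
    then obtain g where g: "emb (6 * l) S (pts y) g" using embeds[of S] by (auto simp: anchored_def)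
    have "g p = p" by (rule image_fixed[OF S]) (rule emb_mono[OF g], use l_pos in auto)
    with S g show ?thesis by blast
  qed
  show "pts x \<subseteq> pts y"
  proof
    fix p assume "p \<in> pts x"
    then obtain S g where "anchored S p" "emb (6 * l) S (pts y) g" "g p = p" using * by blast
    then show "p \<in> pts y" using emb_mem[of "6 * l" S "pts y" g p] by (simp add: anchored_def)
  qed
  assume 1: "1 \<le> ones_at x p"
  then have "p \<in> pts x" by (simp add: pts_iff)
  then obtain S g where "anchored S p" "emb (6 * l) S (pts y) g" "g p = p" using * by blast
  then show "ones_at y p = ones_at x p" using mass_eq[of S p g] 1 by simp
qed

text \<open>By symmetry, points and block lengths agree in both directions, and the number of zeros
  is the largest point.\<close>

lemma strings_eq: "x = y"
proof (rule ones_at_inject)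
  interpret sw: indistinguishable n h l L \<eta> y x by (rule swap)
  show "ones_at x s = ones_at y s" for s
    using ones_at_le[of s] sw.ones_at_le[of s] by (cases "ones_at x s"; cases "ones_at y s") auto
  have eq: "pts x = pts y" using pts_subset sw.pts_subset by blast
  have "zc z (length z) = Max (pts z)" for z
    by (rule Max_eqI[symmetric]) (auto simp: pts_le, simp add: pts_def)
  then show "zc x (length x) = zc y (length y)" using eq by simp
qed

end

section \<open>Runs\<close>

lemma run_containing:
  assumes "k < length x" "x ! k = b"
  obtains i j where "is_run b x i j" "i \<le> k" "k < j"
proof -
  let ?I = "\<lambda>i. i \<le> k \<and> (\<forall>m\<in>{i..k}. x ! m = b)"
  define i where "i = (LEAST i. ?I i)"
  have "?I k" using assms by simp
  then have i: "?I i" unfolding i_def by (rule LeastI)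
  have i0: "i = 0 \<or> x ! (i - 1) \<noteq> b"
  proof (rule ccontr)
    assume a: "\<not> ?thesis"
    have "?I (i - 1)"
    proof (intro conjI ballI)
      fix m assume "m \<in> {i - 1..k}"
      then show "x ! m = b" using a i by (cases "m = i - 1") auto
    qed (use i in auto)
    then have "i \<le> i - 1" unfolding i_def by (rule Least_le)
    then show False using a by auto
  qed
  let ?J = "\<lambda>j. k < j \<and> (j = length x \<or> x ! j \<noteq> b)"
  define j where "j = (LEAST j. ?J j)"
  have len: "?J (length x)" using assms by simp
  then have j: "?J j" unfolding j_def by (rule LeastI)
  have jl: "j \<le> length x" unfolding j_def using len by (rule Least_le)
  have "x ! m = b" if "m \<in> {i..<j}" for m
  proof (cases "m \<le> k")
    case False
    then have "\<not> ?J m" using that not_less_Least[of m ?J] by (simp add: j_def)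
    then show ?thesis using False by simp
  qed (use i that in auto)
  then have "is_run b x i j" unfolding is_run_def using i0 i j jl by auto
  then show ?thesis using that i j by blast
qed

lemma zc_segment: "a \<le> b \<Longrightarrow> (\<And>k. k \<in> {a..<b} \<Longrightarrow> \<not> x ! k) \<Longrightarrow> zc x b = zc x a + (b - a)"
  by (induction rule: dec_induct) (simp_all add: zc_Suc)

text \<open>Between positions \<open>e\<close> and \<open>e'\<close> representing two points there
  is a zero. Its whole run lies between them, because these positions hold ones or are ends of the
  string.\<close>

lemma pts_separated:
  assumes "zero_runs_ge L x"
  shows "separated L (pts x)"
  unfolding separated_def
proof (intro ballI impI)
  fix s s' assume s: "s \<in> pts x" "s' \<in> pts x" "s < s'"
  have "\<exists>e. e \<le> length x \<and> zc x e = s \<and> (e = 0 \<or> x ! e)"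
  proof (cases "s = 0")
    case False
    have "s \<noteq> zc x (length x)" using s(3) pts_le[OF s(2)] by simp
    then obtain e where "e < length x" "x ! e" "s = zc x e" using s(1) False by (auto simp: pts_def)
    then show ?thesis by (intro exI[of _ e]) simp
  qed (intro exI[of _ 0], simp)
  then obtain e where e: "e \<le> length x" "zc x e = s" "e = 0 \<or> x ! e" by blast
  have "\<exists>e'. e' \<le> length x \<and> zc x e' = s' \<and> (e' = length x \<or> x ! e')"
  proof (cases "s' = zc x (length x)")
    case False
    then obtain e where "e < length x" "x ! e" "s' = zc x e" using s(2,3) by (auto simp: pts_def)
    then show ?thesis by (intro exI[of _ e]) simp
  qed (intro exI[of _ "length x"], simp)
  then obtain e' where e': "e' \<le> length x" "zc x e' = s'" "e' = length x \<or> x ! e'" by blast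
  have "e < e'" using zc_mono[of e' e x] e e' s(3) by (cases "e < e'") auto
  have "\<exists>k. e \<le> k \<and> k < e' \<and> \<not> x ! k"
  proof (rule ccontr)
    assume a: "\<not> ?thesis"
    have "{k. k < e' \<and> \<not> x ! k} \<subseteq> {k. k < e \<and> \<not> x ! k}" using a not_less by blast
    then have "zc x e' \<le> zc x e" unfolding zc_def by (intro card_mono) auto
    then show False using e e' s by simp
  qed
  then obtain k where k: "e \<le> k" "k < e'" "\<not> x ! k" by blast
  then obtain i j where run: "is_run False x i j" "i \<le> k" "k < j"
    using run_containing[of k x False] e' by auto
  have z: "\<not> x ! m" if "m \<in> {i..<j}" for m using run that by (auto simp: is_run_def)
  have "e \<le> i" using z[of e] e(3) k run by (cases "e \<le> i") auto
  have "j \<le> e'"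
  proof (rule ccontr)
    assume "\<not> j \<le> e'"
    then have "e' < length x" "\<not> x ! e'" using z[of e'] run k by (auto simp: is_run_def)
    then show False using e'(3) by simp
  qed
  have "L \<le> real (j - i)" using assms run(1) unfolding zero_runs_ge_def by blast
  also have "\<dots> = real (zc x j) - real (zc x i)" using zc_segment[of i j x] z run by simp
  also have "\<dots> \<le> real (zc x e') - real (zc x e)"
    using zc_mono[OF \<open>e \<le> i\<close>, of x] zc_mono[OF \<open>j \<le> e'\<close>, of x] by simp
  finally show "L \<le> real s' - real s" using e e' by simp
qed

text \<open>A point other than the two ends is charged to the change from a zero to the first one of
  its block. This gives at most one more point than runs.\<close>

lemma card_pts: "card (pts x) \<le> 2 * num_runs x"
proof -
  let ?C = "{i. Suc i < length x \<and> x ! i \<noteq> x ! Suc i}"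
  have fin: "finite ?C" by (rule finite_subset[of _ "{..<length x}"]) auto
  have "pts x \<subseteq> {0, zc x (length x)} \<union> (\<lambda>i. zc x (Suc i)) ` ?C"
  proof
    fix s assume s: "s \<in> pts x"
    show "s \<in> {0, zc x (length x)} \<union> (\<lambda>i. zc x (Suc i)) ` ?C"
    proof (cases "s = 0 \<or> s = zc x (length x)")
      case False
      let ?E = "\<lambda>e. e < length x \<and> x ! e \<and> zc x e = s"
      have ex: "\<exists>e. ?E e" using s False by (auto simp: pts_def)
      define e where "e = (LEAST e. ?E e)"
      have e: "?E e" unfolding e_def using ex by (rule LeastI_ex)
      have "e \<noteq> 0" using e False by (cases e) auto
      then obtain i where i: "e = Suc i" by (cases e) auto
      have "\<not> x ! i"
      proof
        assume "x ! i"
        then have "?E i" using e i by (simp add: zc_Suc)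
        then have "e \<le> i" unfolding e_def by (rule Least_le)
        then show False using i by simp
      qed
      then have "i \<in> ?C" "s = zc x (Suc i)" using e i by auto
      then show ?thesis by blast
    qed auto
  qed
  then have "card (pts x) \<le> card ({0, zc x (length x)} \<union> (\<lambda>i. zc x (Suc i)) ` ?C)"
    using fin by (intro card_mono) auto
  also have "\<dots> \<le> card {0, zc x (length x)} + card ((\<lambda>i. zc x (Suc i)) ` ?C)" by (rule card_Un_le)
  also have "\<dots> \<le> 2 + card ?C" using card_image_le[OF fin] by (intro add_mono) (auto simp: card_insert_if)
  finally show ?thesis by (simp add: num_runs_def)
qed

section \<open>Estimation from pairwise tests\<close>

definition freq :: "'b set \<Rightarrow> 'b list \<Rightarrow> real" where
  "freq E ts = real (length (filter (\<lambda>t. t \<in> E) ts)) / real (length ts)"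

lemma map_replicate_pmf: "map_pmf (map f) (replicate_pmf T p) = replicate_pmf T (map_pmf f p)"
proof (induction T)
  case (Suc T)
  have "map_pmf (map f) (replicate_pmf (Suc T) p) =
      bind_pmf p (\<lambda>x. bind_pmf (replicate_pmf T p) (\<lambda>xs. return_pmf (f x # map f xs)))"
    by (simp add: map_bind_pmf)
  also have "\<dots> = bind_pmf p (\<lambda>x. bind_pmf (map_pmf (map f) (replicate_pmf T p)) (\<lambda>xs. return_pmf (f x # xs)))"
    by (simp add: bind_map_pmf)
  also have "\<dots> = replicate_pmf (Suc T) (map_pmf f p)"
    by (simp add: Suc bind_map_pmf)
  finally show ?case .
qed simp

lemma map_pmf_mem: "map_pmf (\<lambda>t. t \<in> E) p = bernoulli_pmf (measure_pmf.prob p E)"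
proof (rule pmf_eqI)
  fix b
  have "(\<lambda>t. t \<in> E) -` {b} = (if b then E else UNIV - E)" by auto
  moreover have "measure_pmf.prob p (UNIV - E) = 1 - measure_pmf.prob p E"
    using measure_pmf.prob_compl[of E p] by simp
  ultimately show "pmf (map_pmf (\<lambda>t. t \<in> E) p) b = pmf (bernoulli_pmf (measure_pmf.prob p E)) b"
    by (cases b) (simp_all add: pmf_map)
qed

lemma freq_deviation:
  assumes "T > 0" "\<epsilon> \<ge> 0"
  shows "measure_pmf.prob (replicate_pmf T p) {ts. \<epsilon> \<le> \<bar>freq E ts - measure_pmf.prob p E\<bar>} \<le> 2 * exp (- 2 * real T * \<epsilon>\<^sup>2)"
proof -
  let ?q = "measure_pmf.prob p E"
  have "binomial_pmf T ?q = map_pmf (length \<circ> filter id) (replicate_pmf T (bernoulli_pmf ?q))"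
    by (rule binomial_pmf_altdef) auto
  also have "\<dots> = map_pmf (\<lambda>ts. length (filter (\<lambda>t. t \<in> E) ts)) (replicate_pmf T p)"
    unfolding map_pmf_mem[symmetric] map_replicate_pmf[symmetric]
    by (simp add: pmf.map_comp o_def filter_map)
  finally have b: "binomial_pmf T ?q = map_pmf (\<lambda>ts. length (filter (\<lambda>t. t \<in> E) ts)) (replicate_pmf T p)" .
  have "measure_pmf.prob (replicate_pmf T p) {ts. \<epsilon> \<le> \<bar>freq E ts - ?q\<bar>} =
    measure_pmf.prob (replicate_pmf T p) {ts. \<epsilon> \<le> \<bar>real (length (filter (\<lambda>t. t \<in> E) ts)) / real T - ?q\<bar>}"
    \<comment> \<open>All lists in the support have length \<open>T\<close>, so the denominator of
      \<open>freq\<close> is \<open>T\<close>.\<close>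
    by (intro measure_pmf.finite_measure_eq_AE) (auto simp: AE_measure_pmf_iff set_replicate_pmf freq_def)
  also have "\<dots> = measure_pmf.prob (binomial_pmf T ?q) {k. \<bar>real k / real T - ?q\<bar> \<ge> \<epsilon>}"
    unfolding b by simp
  also have "\<dots> \<le> 2 * exp (- 2 * real T * \<epsilon>\<^sup>2)"
    using binomial_distribution.prob_abs_ge'[of ?q T \<epsilon>] assms by (simp add: binomial_distribution_def)
  finally show ?thesis .
qed

text \<open>The empirical frequencies of the events \<open>E u v\<close> that tell two candidates \<open>u\<close>, \<open>v\<close> apart
  determine the candidate.\<close>

lemma estimator_exists:
  fixes D :: "'a \<Rightarrow> 'b pmf"
  assumes fin: "finite V" and T: "T > 0" "0 < \<eta>"
    and apart: "\<And>u v. u \<in> V \<Longrightarrow> v \<in> V \<Longrightarrow> u \<noteq> v \<Longrightarrow> \<exists>E. \<eta> < \<bar>measure_pmf.prob (D u) E - measure_pmf.prob (D v) E\<bar>"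
  shows "\<exists>A. \<forall>x\<in>V. 1 - 2 * (real (card V))\<^sup>2 * exp (- real T * \<eta>\<^sup>2 / 2)
    \<le> measure_pmf.prob (replicate_pmf T (D x)) {ts. A ts = x}"
proof -
  obtain E where E: "\<And>u v. u \<in> V \<Longrightarrow> v \<in> V \<Longrightarrow> u \<noteq> v \<Longrightarrow>
      \<eta> < \<bar>measure_pmf.prob (D u) (E u v) - measure_pmf.prob (D v) (E u v)\<bar>"
    using apart by metis
  \<comment> \<open>Consistency with all empirical frequencies. Two consistent candidates would have
    probabilities less than \<eta> apart on the event that tells them apart.\<close>
  define ok where "ok ts x \<longleftrightarrow> x \<in> V \<and> (\<forall>u\<in>V. \<forall>v\<in>V. \<bar>freq (E u v) ts - measure_pmf.prob (D x) (E u v)\<bar> < \<eta> / 2)" for ts x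
  define A where "A ts = (SOME x. ok ts x)" for ts
  have A: "A ts = x" if "ok ts x" for ts x
  proof (rule ccontr)
    assume ne: "A ts \<noteq> x"
    have "ok ts (A ts)" unfolding A_def using that by (rule someI)
    then have "\<bar>freq (E x (A ts)) ts - measure_pmf.prob (D (A ts)) (E x (A ts))\<bar> < \<eta> / 2"
      "\<bar>freq (E x (A ts)) ts - measure_pmf.prob (D x) (E x (A ts))\<bar> < \<eta> / 2" "x \<in> V" "A ts \<in> V"
      using that unfolding ok_def by auto
    then show False using E[of x "A ts"] ne by (auto simp: abs_if split: if_splits)
  qed
  have "1 - 2 * (real (card V))\<^sup>2 * exp (- real T * \<eta>\<^sup>2 / 2) \<le> measure_pmf.prob (replicate_pmf T (D x)) {ts. A ts = x}"
    if x: "x \<in> V" for x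
  proof -
    let ?P = "measure_pmf.prob (replicate_pmf T (D x))"
    let ?bad = "\<lambda>(u, v). {ts. \<eta> / 2 \<le> \<bar>freq (E u v) ts - measure_pmf.prob (D x) (E u v)\<bar>}"
    have "UNIV - {ts. A ts = x} \<subseteq> (\<Union>uv\<in>V \<times> V. ?bad uv)"
    proof
      fix ts assume "ts \<in> UNIV - {ts. A ts = x}"
      then have "\<not> ok ts x" using A by blast
      then show "ts \<in> (\<Union>uv\<in>V \<times> V. ?bad uv)" using x unfolding ok_def by (force simp: not_less)
    qed
    then have "?P (UNIV - {ts. A ts = x}) \<le> ?P (\<Union>uv\<in>V \<times> V. ?bad uv)"
      by (rule measure_pmf.finite_measure_mono) simp
    also have "\<dots> \<le> (\<Sum>uv\<in>V \<times> V. ?P (?bad uv))"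
      by (rule measure_pmf.finite_measure_subadditive_finite) (use fin in auto)
    also have "\<dots> \<le> (\<Sum>uv\<in>V \<times> V. 2 * exp (- 2 * real T * (\<eta> / 2)\<^sup>2))"
      by (rule sum_mono) (use freq_deviation[OF T(1), of "\<eta> / 2"] T in auto)
    also have "\<dots> = 2 * (real (card V))\<^sup>2 * exp (- real T * \<eta>\<^sup>2 / 2)"
      by (simp add: card_cartesian_product power2_eq_square)
    finally show ?thesis using measure_pmf.prob_compl[of "{ts. A ts = x}" "replicate_pmf T (D x)"] by simp
  qed
  then show ?thesis by blast
qed

section \<open>Reconstruction\<close>

lemma pow2_scale: "1 \<le> m \<Longrightarrow> \<exists>h. m \<le> 2 ^ h \<and> 2 ^ h \<le> 2 * (m::nat)"
proof (induction m rule: dec_induct)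
  case base
  show ?case by (intro exI[of _ 0]) simp
next
  case (step m)
  then obtain h where h: "m \<le> 2 ^ h" "2 ^ h \<le> 2 * m" by blast
  show ?case
  proof (cases "Suc m \<le> 2 ^ h")
    case True
    then show ?thesis using h by (intro exI[of _ h]) simp
  next
    case False
    then have "m = 2 ^ h" using h by simp
    then show ?thesis using step.hyps by (intro exI[of _ "Suc h"]) simp
  qed
qed

text \<open>The left side is of order 1 / n^10, the right side of order 1 / n^8. The latter is a
  lower bound for \<open>(1/2) ^ (8 * h + 6)\<close> when \<open>2 ^ h \<le> 6 * n\<close>.\<close>

lemma parameters_eventually:
  "\<forall>\<^sub>F n in sequentially. 8 * (real n)\<^sup>2 * (1 / real n ^ 12 + 2 * bad_prob n (ln (real n))) + bad_prob n (ln (real n))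
    < 1 / (64 * (6 * real n) ^ 8)"
  by real_asymp

text \<open>A common separation is needed, but \<open>y\<close> may have fewer runs and then be
  separated only on a smaller scale. Comparison with \<open>x\<close> first improves the separation
  of \<open>y\<close>.\<close>

lemma indistinguishable_strings_eq:
  fixes x y :: "bool list"
  assumes len: "length x = n" "length y = n" and n: "3 \<le> n"
    and par: "8 * (real n)\<^sup>2 * (\<eta> + 2 * bad_prob n (ln (real n))) + bad_prob n (ln (real n)) < 1 / (64 * (6 * real n) ^ 8)"
    and x: "zero_runs_ge (300000 * real (num_runs x) * ln (real n) ^ 2) x"
    and y: "zero_runs_ge (300000 * real (num_runs y) * ln (real n) ^ 2) y"
    and r: "num_runs y \<le> num_runs x"
    and close: "\<And>A. \<bar>measure_pmf.prob (deletion_channel (1/2) x) A - measure_pmf.prob (deletion_channel (1/2) y) A\<bar> \<le> \<eta>"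
  shows "x = y"
proof -
  define l where "l = ln (real n)"
  \<comment> \<open>Half of the separation of \<open>x\<close>; the factor 2 is spent on
    transferring separation to \<open>y\<close>. With \<open>card_pts\<close>, the bound
    \<open>57600 * 2 \<le> 150000\<close> still suffices for the locale.\<close>
  define L where "L = 150000 * real (num_runs x) * l\<^sup>2"
  have "exp 1 \<le> (3::real)" by (rule exp_le)
  also have "\<dots> \<le> real n" using n by simp
  finally have "exp 1 \<le> real n" .
  then have l1: "1 \<le> l" unfolding l_def using n by (simp add: ln_ge_iff)
  then have l2: "1 \<le> l\<^sup>2" by (rule one_le_power)
  have r1: "1 \<le> real (num_runs x)" "1 \<le> real (num_runs y)" by (simp_all add: num_runs_def)
  have Lge: "150000 * l\<^sup>2 \<le> L"
    unfolding L_def using r1 mult_right_mono[of 1 "real (num_runs x)" "l\<^sup>2"] by simp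
  have sx: "separated (2 * L) (pts x)" using pts_separated[OF x] by (simp add: L_def l_def mult.assoc)
  have sy': "separated (300000 * real (num_runs y) * l\<^sup>2) (pts y)" using pts_separated[OF y] unfolding l_def .
  have Ly: "300000 * l\<^sup>2 \<le> 300000 * real (num_runs y) * l\<^sup>2"
    using r1 mult_right_mono[of 1 "real (num_runs y)" "l\<^sup>2"] by simp
  have sepx: "separated L (pts x)"
  proof -
    have "L \<le> 2 * L" using Lge l2 by linarith
    then show ?thesis using sx unfolding separated_def by (meson order_trans)
  qed
  obtain h where h: "3 * n \<le> 2 ^ h" "2 ^ h \<le> 6 * n" using pow2_scale[of "3 * n"] n by auto
  have eta: "0 \<le> \<eta>" using close[of "{}"] by simp
  have small: "8 * (real n)\<^sup>2 * (\<eta> + 2 * bad_prob n l) + bad_prob n l < (1/2) ^ (8 * h + 6)"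
  proof -
    have "(2::real) ^ h = real (2 ^ h)" by simp
    also have "\<dots> \<le> real (6 * n)" using h(2) by (simp only: of_nat_le_iff)
    finally have "((2::real) ^ h) ^ 8 \<le> (6 * real n) ^ 8" by (intro power_mono) auto
    then have "(2::real) ^ (8 * h + 6) \<le> 64 * (6 * real n) ^ 8"
      by (simp add: power_add power_mult[symmetric] mult.commute)
    then have "1 / (64 * (6 * real n) ^ 8) \<le> 1 / (2::real) ^ (8 * h + 6)"
      by (intro divide_left_mono) (use n in auto)
    also have "\<dots> = (1/2) ^ (8 * h + 6)" by (simp add: power_one_over)
    finally show ?thesis using par unfolding l_def by linarith
  qed
  have small2: "\<eta> + 2 * bad_prob n l < (1/2) ^ 2"
  proof -
    have "1 \<le> (real n)\<^sup>2" using n by (intro one_le_power) simp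
    then have "1 * (\<eta> + 2 * bad_prob n l) \<le> (8 * (real n)\<^sup>2) * (\<eta> + 2 * bad_prob n l)"
      using eta by (intro mult_right_mono) auto
    then have "\<eta> + 2 * bad_prob n l \<le> (8 * (real n)\<^sup>2) * (\<eta> + 2 * bad_prob n l)"
      by (simp only: mult_1)
    also have "\<dots> \<le> 8 * (real n)\<^sup>2 * (\<eta> + 2 * bad_prob n l) + bad_prob n l"
      by (simp only: le_add_same_cancel1) simp
    also note small
    also have "(1/2::real) ^ (8 * h + 6) \<le> (1/2) ^ 2" by (intro power_decreasing) auto
    finally show ?thesis .
  qed
  have close': "\<bar>measure_pmf.prob (deletion_channel (1/2) y) A - measure_pmf.prob (deletion_channel (1/2) x) A\<bar> \<le> \<eta>" for A
    using close[of A] by (simp add: abs_minus_commute)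
  \<comment> \<open>Two points of \<open>y\<close> closer than \<open>L\<close> would embed into
    \<open>pts x\<close> with their distance at most doubled, against the separation
    \<open>2 * L\<close> of \<open>x\<close>.\<close>
  have sepy: "separated L (pts y)"
    unfolding separated_def
  proof (intro ballI impI, rule ccontr)
    fix s s' assume s: "s \<in> pts y" "s' \<in> pts y" "s < s'" "\<not> L \<le> real s' - real s"
    let ?S = "{s, s'}"
    have S: "?S \<subseteq> pts y" using s by simp
    note sepS = separated_subset[OF sy' S]
    have "\<exists>g. emb (6 * l) ?S (pts x) g"
    proof (rule embedding_exists[OF len(2,1) close' S sepS])
      show "16 * l\<^sup>2 \<le> 300000 * real (num_runs y) * l\<^sup>2" using Ly l2 by linarith
      have "card ?S = 2" using s(3) by simp
      then show "\<eta> + 2 * bad_prob n l < (1/2) ^ card ?S" using small2 by (simp only:)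
    qed (use l1 in auto)
    then obtain g where g: "emb (6 * l) ?S (pts x) g" by blast
    have lt: "g s < g s'"
    proof (rule emb_less[OF g sepS])
      show "(6 * l)\<^sup>2 < 300000 * real (num_runs y) * l\<^sup>2" using Ly l2 by (simp add: power_mult_distrib)
    qed (use l1 s in auto)
    have "300000 * l\<^sup>2 \<le> \<bar>real s' - real s\<bar>" using separatedD[OF sy' s(2,1)] s(3) Ly by linarith
    then have "6 * l * sqrt \<bar>real s' - real s\<bar> \<le> 1 * \<bar>real s' - real s\<bar>"
      using l2 by (intro mult_sqrt_le) (auto simp: power_mult_distrib)
    moreover have "\<bar>(real (g s') - real (g s)) - (real s' - real s)\<bar> \<le> 6 * l * sqrt \<bar>real s' - real s\<bar>"
      using embD[OF g, of s' s] by simp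
    ultimately have "\<bar>(real (g s') - real (g s)) - (real s' - real s)\<bar> \<le> real s' - real s"
      using s(3) by simp
    then have "real (g s') - real (g s) < 2 * L" using s(4) by linarith
    moreover have "2 * L \<le> real (g s') - real (g s)"
      using sx lt emb_mem[OF g] by (auto simp: separated_def)
    ultimately show False by simp
  qed
  have card: "57600 * l\<^sup>2 * real (card (pts z)) \<le> L" if "num_runs z \<le> num_runs x" for z
  proof -
    have "card (pts z) \<le> 2 * num_runs x" using card_pts[of z] that by linarith
    then have "57600 * l\<^sup>2 * real (card (pts z)) \<le> 57600 * l\<^sup>2 * real (2 * num_runs x)"
      by (intro mult_left_mono) auto
    also have "\<dots> \<le> L" unfolding L_def using r1 l2 by simp
    finally show ?thesis .
  qed
  have "indistinguishable n h l L \<eta> x y"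
  proof (rule indistinguishable.intro[OF len close sepx sepy])
    show "1 \<le> L" using Lge l2 by linarith
    show "57600 * l\<^sup>2 * real (card (pts x)) \<le> L" "57600 * l\<^sup>2 * real (card (pts y)) \<le> L"
      using card r by auto
    show "8 * (real n)\<^sup>2 * (\<eta> + 2 * bad_prob n l) + bad_prob n l < (1/2) ^ (8 * h + 6)" by (rule small)
  qed (use l1 n h(1) in auto)
  then show ?thesis by (rule indistinguishable.strings_eq)
qed

text \<open>By contraposition, where the string with at least as many runs takes the role of
  \<open>x\<close>.\<close>

lemma channels_apart:
  "\<exists>n0. \<forall>n\<ge>n0. \<forall>x y. length x = n \<longrightarrow> length y = n \<longrightarrow> x \<noteq> y \<longrightarrow>
     zero_runs_ge (300000 * real (num_runs x) * ln (real n) ^ 2) x \<longrightarrow>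
     zero_runs_ge (300000 * real (num_runs y) * ln (real n) ^ 2) y \<longrightarrow>
     (\<exists>A. 1 / real n ^ 12 < \<bar>measure_pmf.prob (deletion_channel (1/2) x) A - measure_pmf.prob (deletion_channel (1/2) y) A\<bar>)"
proof -
  obtain n1 where n1: "\<And>n. n1 \<le> n \<Longrightarrow> 8 * (real n)\<^sup>2 * (1 / real n ^ 12 + 2 * bad_prob n (ln (real n))) + bad_prob n (ln (real n))
    < 1 / (64 * (6 * real n) ^ 8)"
    using parameters_eventually unfolding eventually_sequentially by blast
  have "\<exists>A. 1 / real n ^ 12 < \<bar>measure_pmf.prob (deletion_channel (1/2) x) A - measure_pmf.prob (deletion_channel (1/2) y) A\<bar>"
    if "max 3 n1 \<le> n" "length x = n" "length y = n" "x \<noteq> y"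
      "zero_runs_ge (300000 * real (num_runs x) * ln (real n) ^ 2) x"
      "zero_runs_ge (300000 * real (num_runs y) * ln (real n) ^ 2) y" for n x y
  proof (rule ccontr)
    assume "\<not> ?thesis"
    then have close: "\<bar>measure_pmf.prob (deletion_channel (1/2) x) A - measure_pmf.prob (deletion_channel (1/2) y) A\<bar> \<le> 1 / real n ^ 12"
      "\<bar>measure_pmf.prob (deletion_channel (1/2) y) A - measure_pmf.prob (deletion_channel (1/2) x) A\<bar> \<le> 1 / real n ^ 12" for A
      by (auto simp: not_less abs_minus_commute)
    have n: "3 \<le> n" "n1 \<le> n" using that(1) by auto
    show False
    proof (cases "num_runs y \<le> num_runs x")
      case True
      show False using indistinguishable_strings_eq[OF that(2,3) n(1) n1[OF n(2)] that(5,6) True close(1)] that(4) by simp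
    next
      case False
      then have "num_runs x \<le> num_runs y" by simp
      show False using indistinguishable_strings_eq[OF that(3,2) n(1) n1[OF n(2)] that(6,5) \<open>num_runs x \<le> num_runs y\<close> close(2)] that(4) by simp
    qed
  qed
  then show ?thesis by blast
qed

theorem theorem9:
  shows "\<exists>(C::real) (c::nat) (d::nat) (T :: nat \<Rightarrow> nat)
           (A :: nat \<Rightarrow> bool list list \<Rightarrow> bool list) (\<epsilon> :: nat \<Rightarrow> real).
           C > 0 \<and>
           (\<lambda>n. real (T n)) \<in> O(\<lambda>n. real n ^ d) \<and>
           \<epsilon> \<longlonglongrightarrow> 0 \<and>
           (\<forall>n x. length x = n \<longrightarrow>
              zero_runs_ge (C * real (num_runs x) * ln (real n) ^ c) x \<longrightarrow>
              measure_pmf.prob (traces (T n) (1/2) x) {ts. A n ts = x} \<ge> 1 - \<epsilon> n)"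
proof -
  define V where "V n = {x. length x = n \<and> zero_runs_ge (300000 * real (num_runs x) * ln (real n) ^ 2) x}" for n
  \<comment> \<open>Chosen as \<open>8 * n\<close> times the square of \<open>n ^ 12\<close>, so
    that the exponent in \<open>estimator_exists\<close> becomes \<open>- 4 * n\<close>, which beats
    the at most \<open>4 ^ n\<close> pairs.\<close>
  define T where "T n = 8 * n ^ 25" for n :: nat
  obtain n0 where n0: "\<And>n x y. n0 \<le> n \<Longrightarrow> x \<in> V n \<Longrightarrow> y \<in> V n \<Longrightarrow> x \<noteq> y \<Longrightarrow>
     \<exists>A. 1 / real n ^ 12 < \<bar>measure_pmf.prob (deletion_channel (1/2) x) A - measure_pmf.prob (deletion_channel (1/2) y) A\<bar>"
    using channels_apart unfolding V_def by blast
  \<comment> \<open>The value 1 makes the claim trivial for the finitely many small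
    \<open>n\<close>.\<close>
  define \<epsilon> where "\<epsilon> n = (if max 1 n0 \<le> n then 2 * 4 ^ n * exp (- 4 * real n) else 1)" for n
  have finV: "finite (V n)" and cardV: "card (V n) \<le> 2 ^ n" for n
  proof -
    have sub: "V n \<subseteq> {x. set x \<subseteq> UNIV \<and> length x = n}" by (auto simp: V_def)
    have fin: "finite {x :: bool list. set x \<subseteq> UNIV \<and> length x = n}" by (rule finite_lists_length_eq) simp
    show "finite (V n)" using sub fin by (rule finite_subset)
    show "card (V n) \<le> 2 ^ n"
      using card_mono[OF fin sub] card_lists_length_eq[of "UNIV :: bool set" n] by simp
  qed
  have "\<exists>A. \<forall>x\<in>V n. 1 - \<epsilon> n \<le> measure_pmf.prob (traces (T n) (1/2) x) {ts. A ts = x}" for n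
  proof (cases "max 1 n0 \<le> n")
    case True
    then have n: "1 \<le> n" "n0 \<le> n" by auto
    obtain A where A: "\<forall>x\<in>V n. 1 - 2 * (real (card (V n)))\<^sup>2 * exp (- real (T n) * (1 / real n ^ 12)\<^sup>2 / 2)
        \<le> measure_pmf.prob (replicate_pmf (T n) (deletion_channel (1/2) x)) {ts. A ts = x}"
      using estimator_exists[OF finV, of "T n" "1 / real n ^ 12" n "deletion_channel (1/2)"] n0[OF n(2)] n(1)
      by (auto simp: T_def)
    have "real n ^ 25 = real n * (real n ^ 12)\<^sup>2"
      by (simp add: power_mult[symmetric] power_Suc[symmetric] del: power_Suc)
    then have "- real (T n) * (1 / real n ^ 12)\<^sup>2 / 2 = - 4 * real n"
      using n by (simp add: T_def power_divide)
    moreover have "(real (card (V n)))\<^sup>2 \<le> 4 ^ n"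
    proof -
      have "real (card (V n)) \<le> 2 ^ n" using of_nat_mono[OF cardV[of n], where 'a=real] by simp
      then have "(real (card (V n)))\<^sup>2 \<le> (2 ^ n)\<^sup>2" by (intro power_mono) auto
      also have "\<dots> = 4 ^ n" by (simp add: power_mult[symmetric] mult.commute[of n]) (simp add: power_mult)
      finally show ?thesis .
    qed
    ultimately have "2 * (real (card (V n)))\<^sup>2 * exp (- real (T n) * (1 / real n ^ 12)\<^sup>2 / 2) \<le> \<epsilon> n"
      using True by (simp add: \<epsilon>_def)
    then show ?thesis using A unfolding traces_def by (intro exI[of _ A]) force
  next
    case False
    then show ?thesis by (auto simp: \<epsilon>_def)
  qed
  then obtain A where A: "\<And>n x. x \<in> V n \<Longrightarrow> 1 - \<epsilon> n \<le> measure_pmf.prob (traces (T n) (1/2) x) {ts. A n ts = x}"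
    by metis
  have "(\<lambda>n. 2 * 4 ^ n * exp (- 4 * real n)) \<longlonglongrightarrow> 0" by real_asymp
  moreover have "\<forall>\<^sub>F n in sequentially. 2 * 4 ^ n * exp (- 4 * real n) = \<epsilon> n"
    using eventually_ge_at_top[of "max 1 n0"] by eventually_elim (simp add: \<epsilon>_def)
  ultimately have "\<epsilon> \<longlonglongrightarrow> 0" by (rule Lim_transform_eventually)
  moreover have "(\<lambda>n. real (T n)) \<in> O(\<lambda>n. real n ^ 25)" by (simp add: T_def)
  ultimately show ?thesis
    using A by (intro exI[of _ 300000] exI[of _ 2] exI[of _ 25] exI[of _ T] exI[of _ A] exI[of _ \<epsilon>])
      (auto simp: V_def)
qed

end
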